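(* Let $G$ be a word-hyperbolic group and let $S$ be a finite generating set for $G$ as a semigroup. Let $\phi_S:G\to\mathbb{Z}$ be the function giving word length with respect to $S$, and $\phi_{S^{-1}}:G\to\mathbb{Z}$ the function giving word length with respect to $S^{-1}=\{s^{-1}:s\in S\}$ (both are bicombable). Then $\psi_S:=\phi_S-\phi_{S^{-1}}$ is a bicombable quasimorphism.
   Context: A quasimorphism is a real-valued function $\phi$ on $G$ for which there is $D$ with $|\phi(a)+\phi(b)-\phi(ab)|\le D$ for all $a,b\in G$. Bicombability is defined with respect to a finite symmetric generating set $A$ of $G$ and a combing $L\subset A^*$. Here $A^*$ is the set of finite words in $A$; for $w\in A^*$, $|w|$ is its length and $\overline{w}\in G$ its evaluation. A finite digraph $\Gamma$ with initial vertex $v_1$, whose edges are labeled by letters of $A$ with at most one outgoing edge with any given label at each vertex, parameterizes a prefix-closed language $L\subset A^*$ if $L$ is exactly the set of words read along directed paths starting at $v_1$; a prefix-closed language is regular iff it is parameterized by some such $\Gamma$. A combing of $G$ with respect to $A$ is a prefix-closed regular language $L\subset A^*$ such that evaluation $L\to G$ is a bijection and every $w\in L$ is geodesic. $\phi:G\to\mathbb{Z}$ is weakly combable with respect to $A,L$ if there are a digraph $\Gamma$ parameterizing $L$ and a function $d\phi$ from its vertices to $\mathbb{Z}$ with $\phi(\overline{w})=\sum_{i=0}^{|w|}d\phi(\gamma(i))$ for all $w\in L$, where $\gamma$ is the path in $\Gamma$ starting at $v_1$ corresponding to $w$ and $\gamma(i)$ is the vertex reached after $i$ edges ($\gamma(0)=v_1$).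 It is bicombable if moreover there is $C$ with $|\phi(as)-\phi(a)|\le C$ and $|\phi(sa)-\phi(a)|\le C$ for all $a\in G$, $s\in A$. For word-hyperbolic $G$, bicombability does not depend on the choice of $A$ and $L$. *)

theory Defs
  imports "HOL-Algebra.Algebra"
begin

definition eval_word :: "('a, 'b) monoid_scheme \<Rightarrow> 'a list \<Rightarrow> 'a" where
  "eval_word G w = foldr (\<otimes>\<^bsub>G\<^esub>) w \<one>\<^bsub>G\<^esub>"

text \<open>Only positive words are used, so \<open>S\<close> need not be symmetric. The identity has length 0.
  The value is meaningful only if \<open>g\<close> is represented by some word in \<open>S\<close>.\<close>
definition word_length :: "('a, 'b) monoid_scheme \<Rightarrow> 'a set \<Rightarrow> 'a \<Rightarrow> nat" where
  "word_length G S g = (LEAST n. \<exists>w \<in> lists S. length w = n \<and> eval_word G w = g)"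

text \<open>The subsemigroup generated by \<open>S\<close> consists of the values of \<^emph>\<open>nonempty\<close> words.\<close>
definition semigroup_generating_set :: "('a, 'b) monoid_scheme \<Rightarrow> 'a set \<Rightarrow> bool" where
  "semigroup_generating_set G S \<longleftrightarrow>
     S \<subseteq> carrier G \<and> (\<forall>g \<in> carrier G. \<exists>w \<in> lists S. w \<noteq> [] \<and> eval_word G w = g)"

definition symmetric_generating_set :: "('a, 'b) monoid_scheme \<Rightarrow> 'a set \<Rightarrow> bool" where
  "symmetric_generating_set G A \<longleftrightarrow>
     finite A \<and> A \<subseteq> carrier G \<and> set_inv\<^bsub>G\<^esub> A = A \<and> generate G A = carrier G"

definition geodesic_word :: "('a, 'b) monoid_scheme \<Rightarrow> 'a set \<Rightarrow> 'a list \<Rightarrow> bool" where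
  "geodesic_word G A w \<longleftrightarrow> w \<in> lists A \<and> length w = word_length G A (eval_word G w)"

definition word_dist :: "('a, 'b) monoid_scheme \<Rightarrow> 'a set \<Rightarrow> 'a \<Rightarrow> 'a \<Rightarrow> nat" where
  "word_dist G A x y = word_length G A (inv\<^bsub>G\<^esub> x \<otimes>\<^bsub>G\<^esub> y)"

text \<open>The geodesic is given by its vertices \<open>p 0, \<dots>, p n\<close>; later values of \<open>p\<close> are irrelevant.\<close>
definition cayley_geodesic ::
    "('a, 'b) monoid_scheme \<Rightarrow> 'a set \<Rightarrow> (nat \<Rightarrow> 'a) \<Rightarrow> nat \<Rightarrow> 'a \<Rightarrow> 'a \<Rightarrow> bool" where
  "cayley_geodesic G A p n x y \<longleftrightarrow>
     p 0 = x \<and> p n = y \<and> (\<forall>i \<le> n. p i \<in> carrier G) \<and>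
     (\<forall>i j. i \<le> j \<and> j \<le> n \<longrightarrow> word_dist G A (p i) (p j) = j - i)"

text \<open>Rips' slim triangle condition for the Cayley graph: each side of a geodesic triangle lies in
  the \<open>\<delta>\<close>-neighbourhood of the union of the other two. Corners and points of the sides are taken to
  be vertices of the Cayley graph; allowing interior points of edges would only change the value
  of \<open>\<delta>\<close>.\<close>
definition slim_triangles :: "('a, 'b) monoid_scheme \<Rightarrow> 'a set \<Rightarrow> nat \<Rightarrow> bool" where
  "slim_triangles G A \<delta> \<longleftrightarrow>
     (\<forall>x y z p q r l m n.
        cayley_geodesic G A p l x y \<and> cayley_geodesic G A q m y z \<and> cayley_geodesic G A r n x z \<longrightarrow>
        (\<forall>i \<le> l. (\<exists>j \<le> m. word_dist G A (p i) (q j) \<le> \<delta>) \<or>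
                 (\<exists>j \<le> n. word_dist G A (p i) (r j) \<le> \<delta>)))"

text \<open>The condition does not depend on the choice of \<open>A\<close>.\<close>
definition word_hyperbolic :: "('a, 'b) monoid_scheme \<Rightarrow> bool" where
  "word_hyperbolic G \<longleftrightarrow>
     group G \<and> (\<exists>A \<delta>. symmetric_generating_set G A \<and> slim_triangles G A \<delta>)"

text \<open>A labelled digraph has vertices \<open>V\<close>, initial vertex \<open>v\<close> and edges \<open>(x, a, y) \<in> E\<close> from \<open>x\<close>
  to \<open>y\<close> labelled \<open>a\<close>. Vertices are taken to be natural numbers, which up to isomorphism
  covers all finite digraphs. Since outgoing edges at a vertex have distinct labels, an edge is
  determined by its triple.\<close>
definition labelled_digraph ::
    "'a set \<Rightarrow> nat set \<Rightarrow> nat \<Rightarrow> (nat \<times> 'a \<times> nat) set \<Rightarrow> bool" where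
  "labelled_digraph A V v E \<longleftrightarrow>
     finite V \<and> v \<in> V \<and> E \<subseteq> V \<times> A \<times> V \<and>
     (\<forall>x a y y'. (x, a, y) \<in> E \<and> (x, a, y') \<in> E \<longrightarrow> y = y')"

text \<open>The directed path from \<open>v\<close> with vertices \<open>\<gamma> ! 0, \<dots>, \<gamma> ! length w\<close> reads the word \<open>w\<close>.\<close>
definition path_reading ::
    "nat \<Rightarrow> (nat \<times> 'a \<times> nat) set \<Rightarrow> 'a list \<Rightarrow> nat list \<Rightarrow> bool" where
  "path_reading v E w \<gamma> \<longleftrightarrow>
     length \<gamma> = Suc (length w) \<and> \<gamma> ! 0 = v \<and>
     (\<forall>i < length w. (\<gamma> ! i, w ! i, \<gamma> ! Suc i) \<in> E)"

definition parameterizes ::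
    "'a set \<Rightarrow> nat set \<Rightarrow> nat \<Rightarrow> (nat \<times> 'a \<times> nat) set \<Rightarrow> 'a list set \<Rightarrow> bool" where
  "parameterizes A V v E L \<longleftrightarrow>
     labelled_digraph A V v E \<and> L = {w. \<exists>\<gamma>. path_reading v E w \<gamma>}"

definition prefix_closed :: "'a list set \<Rightarrow> bool" where
  "prefix_closed L \<longleftrightarrow> (\<forall>u w. u @ w \<in> L \<longrightarrow> u \<in> L)"

text \<open>Regularity of the prefix-closed language \<open>L\<close> is expressed by a parameterizing digraph.\<close>
definition combing :: "('a, 'b) monoid_scheme \<Rightarrow> 'a set \<Rightarrow> 'a list set \<Rightarrow> bool" where
  "combing G A L \<longleftrightarrow>
     L \<subseteq> lists A \<and> prefix_closed L \<and> (\<exists>V v E. parameterizes A V v E L) \<and>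
     bij_betw (eval_word G) L (carrier G) \<and> (\<forall>w \<in> L. geodesic_word G A w)"

text \<open>The digraph need not be the one witnessing regularity of \<open>L\<close>. The path \<open>\<gamma>\<close> reading \<open>w \<in> L\<close>
  exists and is unique, since the digraph parameterizes \<open>L\<close>.\<close>
definition weakly_combable_wrt ::
    "('a, 'b) monoid_scheme \<Rightarrow> 'a set \<Rightarrow> 'a list set \<Rightarrow> ('a \<Rightarrow> int) \<Rightarrow> bool" where
  "weakly_combable_wrt G A L \<phi> \<longleftrightarrow>
     (\<exists>V v E. parameterizes A V v E L \<and>
        (\<exists>d\<phi> :: nat \<Rightarrow> int. \<forall>w \<in> L. \<forall>\<gamma>. path_reading v E w \<gamma> \<longrightarrow>
           \<phi> (eval_word G w) = (\<Sum>i = 0..length w. d\<phi> (\<gamma> ! i))))"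

definition bicombable_wrt ::
    "('a, 'b) monoid_scheme \<Rightarrow> 'a set \<Rightarrow> 'a list set \<Rightarrow> ('a \<Rightarrow> int) \<Rightarrow> bool" where
  "bicombable_wrt G A L \<phi> \<longleftrightarrow>
     weakly_combable_wrt G A L \<phi> \<and>
     (\<exists>C. \<forall>a \<in> carrier G. \<forall>s \<in> A.
        \<bar>\<phi> (a \<otimes>\<^bsub>G\<^esub> s) - \<phi> a\<bar> \<le> C \<and> \<bar>\<phi> (s \<otimes>\<^bsub>G\<^esub> a) - \<phi> a\<bar> \<le> C)"

text \<open>For word-hyperbolic groups combings exist and bicombability does not depend on \<open>A\<close> and \<open>L\<close>,
  so this agrees with bicombability for some, equivalently every, choice. Existence is required
  explicitly, so that the universal quantification is never vacuous.\<close>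
definition bicombable :: "('a, 'b) monoid_scheme \<Rightarrow> ('a \<Rightarrow> int) \<Rightarrow> bool" where
  "bicombable G \<phi> \<longleftrightarrow>
     (\<exists>A L. symmetric_generating_set G A \<and> combing G A L) \<and>
     (\<forall>A L. symmetric_generating_set G A \<and> combing G A L \<longrightarrow> bicombable_wrt G A L \<phi>)"

definition quasimorphism :: "('a, 'b) monoid_scheme \<Rightarrow> ('a \<Rightarrow> real) \<Rightarrow> bool" where
  "quasimorphism G \<phi> \<longleftrightarrow>
     (\<exists>D. \<forall>a \<in> carrier G. \<forall>b \<in> carrier G. \<bar>\<phi> a + \<phi> b - \<phi> (a \<otimes>\<^bsub>G\<^esub> b)\<bar> \<le> D)"

end

(*
  In a word-hyperbolic group every point of an A-geodesic lies uniformly close to every S-geodesic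
  with the same endpoints, for any finite sets A and S generating the group as a semigroup: both
  kinds of paths are quasi-geodesics for a generating set with slim triangles. Hence if g lies on an
  A-geodesic from 1 to gu, some S-geodesic from 1 to gu passes through a point gk with k in a fixed
  ball, and the increment from g to gu of the S-length is the minimum over k of the increment from
  g to gk plus the S-distance from k to u. So the future increments along a combing word depend only
  on finitely much data, and a Myhill-Nerode construction gives weak combability. Combings exist
  because the futures of shortlex words are determined by finite local data in the same way.

  For the quasimorphism property let c be a centre of the triangle 1, a, ab, and d the directed
  S-distance. Up to a constant d(x, y) = d(x, c) + d(c, y) for any two corners x, y, and
  psi(g) = d(1, g) - d(g, 1); in psi(a) + psi(b) - psi(ab) the terms involving c cancel.
*)
theory Submission
  imports Defs "HOL-Real_Asymp.Real_Asymp"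
begin

text \<open>Since \<open>S\<close> is not symmetric, the \<open>S\<close>-distance is directed, and
  no thin-triangle argument can be run in it. An \<open>S\<close>-geodesic therefore enters only as
  a sequence of vertices in the undirected metric of a generating set with slim triangles; what is
  learnt there goes back to the \<open>S\<close>-distance through triangle inequalities, at the
  price of a bounded detour in each direction.

  \<open>bicombable\<close> asks for every \<open>A\<close> and \<open>L\<close>, and no
  independence theorem is invoked: each pair is treated directly, with a profile that measures its
  ball in \<open>A\<close> and its lengths in \<open>S\<close>. Both continuations compared are then
  \<open>A\<close>-geodesic, which turns a one-sided estimate for increments into an equality.
  Existence of a combing cannot rest on this equality, because whether the second continuation is
  geodesic is what has to be decided; cone types supply that.

  In the metric part, points of intervals stand for points of geodesics, and integer values let
  maxima and unit steps replace compactness and connectedness.\<close>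

section \<open>Quasi-geodesics in slim integer metric spaces\<close>

locale slim_metric =
  fixes U :: "'a set" and d :: "'a \<Rightarrow> 'a \<Rightarrow> nat" and \<delta> :: nat
  assumes dist_refl: "x \<in> U \<Longrightarrow> d x x = 0"
    and dist_sym: "x \<in> U \<Longrightarrow> y \<in> U \<Longrightarrow> d x y = d y x"
    and dist_tri: "x \<in> U \<Longrightarrow> y \<in> U \<Longrightarrow> z \<in> U \<Longrightarrow> d x z \<le> d x y + d y z"
    and geodesic: "x \<in> U \<Longrightarrow> y \<in> U \<Longrightarrow> t \<le> d x y \<Longrightarrow> \<exists>p\<in>U. d x p = t \<and> t + d p y = d x y"
    and slim: "x \<in> U \<Longrightarrow> y \<in> U \<Longrightarrow> z \<in> U \<Longrightarrow> p \<in> U \<Longrightarrow> d x p + d p y = d x y \<Longrightarrow>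
      \<exists>q\<in>U. (d x q + d q z = d x z \<or> d z q + d q y = d z y) \<and> d p q \<le> \<delta>"
begin

definition btw :: "'a \<Rightarrow> 'a \<Rightarrow> 'a \<Rightarrow> bool" where
  "btw x p y \<longleftrightarrow> x \<in> U \<and> p \<in> U \<and> y \<in> U \<and> d x p + d p y = d x y"

lemma btw_sym: "btw x p y \<Longrightarrow> btw y p x"
  unfolding btw_def using dist_sym by (metis add.commute)

lemma btw_slim:
  assumes "btw x p y" "z \<in> U"
  shows "\<exists>q. (btw x q z \<or> btw z q y) \<and> d p q \<le> \<delta>"
  using assms slim[of x y z p] unfolding btw_def by blast

lemma btw_left_trans: "btw x q e \<Longrightarrow> btw x y q \<Longrightarrow> btw x y e \<and> btw y q e"
  unfolding btw_def using dist_tri[of x y e] dist_tri[of y q e] by auto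

lemma btw_middle:
  assumes "btw x q e" "btw x y q" "btw q z e"
  shows "btw y q z"
proof -
  have "btw y q e" using assms btw_left_trans by blast
  then show ?thesis using btw_sym btw_left_trans assms(3) by blast
qed

section \<open>Stability of quasi-geodesics (Morse lemma)\<close>

text \<open>Cut the path at its middle index: slimness moves \<open>p\<close> by
  \<open>\<delta>\<close> to an interval over one of the halves. So \<open>N\<close> halvings cost
  \<open>\<delta> * N\<close> and leave at most one step, of length at most \<open>M\<close>; the
  distance grows only logarithmically with the number of steps.\<close>

lemma exponential_divergence:
  assumes "\<And>i. a \<le> i \<Longrightarrow> i < b \<Longrightarrow> d (P i) (P (Suc i)) \<le> M"
    and "\<And>i. a \<le> i \<Longrightarrow> i \<le> b \<Longrightarrow> P i \<in> U"
    and "a \<le> b" "b - a \<le> 2 ^ N" "btw (P a) p (P b)"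
  shows "\<exists>j. a \<le> j \<and> j \<le> b \<and> d p (P j) \<le> \<delta> * N + M"
  using assms
proof (induction N arbitrary: a b p)
  case 0
  have "d (P a) (P b) \<le> M"
  proof (cases "a = b")
    case True then show ?thesis using 0 dist_refl by simp
  next
    case False
    then have "b = Suc a" using 0 by simp
    then show ?thesis using 0 by auto
  qed
  moreover have "d p (P a) = d (P a) p" using 0(5) dist_sym unfolding btw_def by auto
  ultimately have "d p (P a) \<le> M" using 0(5) unfolding btw_def by linarith
  then show ?case using 0 by auto
next
  case (Suc N)
  define m where "m = a + (b - a) div 2"
  have m: "a \<le> m" "m \<le> b" using Suc.prems unfolding m_def by auto
  have le: "m - a \<le> 2 ^ N" "b - m \<le> 2 ^ N" using Suc.prems(4) unfolding m_def by auto
  have "P m \<in> U" using Suc.prems m by simp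
  then obtain q where q: "btw (P a) q (P m) \<or> btw (P m) q (P b)" "d p q \<le> \<delta>"
    using btw_slim Suc.prems(5) by blast
  then have "\<exists>j. a \<le> j \<and> j \<le> b \<and> d q (P j) \<le> \<delta> * N + M"
  proof (elim disjE)
    assume "btw (P a) q (P m)"
    then obtain j where "a \<le> j" "j \<le> m" "d q (P j) \<le> \<delta> * N + M"
      using Suc.IH[of a m q] Suc.prems(1,2) m le by auto
    then show ?thesis using m by (intro exI[of _ j]) simp
  next
    assume "btw (P m) q (P b)"
    then obtain j where "m \<le> j" "j \<le> b" "d q (P j) \<le> \<delta> * N + M"
      using Suc.IH[of m b q] Suc.prems(1,2) m le by auto
    then show ?thesis using m by (intro exI[of _ j]) simp
  qed
  then obtain j where j: "a \<le> j" "j \<le> b" "d q (P j) \<le> \<delta> * N + M" by blast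
  have "d p (P j) \<le> d p q + d q (P j)"
    using dist_tri[of p q "P j"] Suc.prems(2,5) q(1) j unfolding btw_def by blast
  then show ?case using j q(2) by (intro exI[of _ j]) auto
qed

text \<open>The lower bound carries no additive constant, because the paths meant here are geodesics
  of another word metric on the same group.\<close>

definition quasi_geodesic :: "nat \<Rightarrow> nat \<Rightarrow> (nat \<Rightarrow> 'a) \<Rightarrow> nat \<Rightarrow> bool" where
  "quasi_geodesic M K P n \<longleftrightarrow>
     (\<forall>i\<le>n. P i \<in> U) \<and> (\<forall>i<n. d (P i) (P (Suc i)) \<le> M) \<and>
     (\<forall>i j. i \<le> j \<and> j \<le> n \<longrightarrow> j - i \<le> K * d (P i) (P j))"

text \<open>On a quasi-geodesic the number of steps, and with it the number of halvings, is governed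
  by the distance of the endpoints. The order of \<open>a\<close> and \<open>b\<close> is left open,
  since the jump points of the Morse argument come in no known order.\<close>

lemma exponential_divergence_quasi:
  assumes P: "quasi_geodesic M K P n" and "a \<le> n" "b \<le> n"
    and "btw (P a) p (P b)" "K * d (P a) (P b) \<le> 2 ^ N"
  shows "\<exists>j\<le>n. d p (P j) \<le> \<delta> * N + M"
proof -
  have *: "\<exists>j\<le>n. d p (P j) \<le> \<delta> * N + M"
    if "a \<le> b" "b \<le> n" "btw (P a) p (P b)" "K * d (P a) (P b) \<le> 2 ^ N" for a b
  proof -
    have "b - a \<le> 2 ^ N" using P that unfolding quasi_geodesic_def by (meson le_trans)
    then have "\<exists>j. a \<le> j \<and> j \<le> b \<and> d p (P j) \<le> \<delta> * N + M"
      using that P unfolding quasi_geodesic_def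
      by (intro exponential_divergence) auto
    then show ?thesis using that le_trans by blast
  qed
  show ?thesis
  proof (cases "a \<le> b")
    case True then show ?thesis using * assms by blast
  next
    case False
    have "d (P a) (P b) = d (P b) (P a)" using assms(4) dist_sym unfolding btw_def by blast
    then show ?thesis using False *[of b a] assms btw_sym by auto
  qed
qed

text \<open>Exponential beats linear growth. In the Morse argument \<open>k * D\<close> bounds a
  number of steps and \<open>c + e * N\<close> the resulting distance, which must not be below
  \<open>D\<close>.\<close>

lemma ex_exponent:
  fixes c k e :: nat
  shows "\<exists>D0. \<forall>D>D0. \<exists>N. k * D \<le> 2 ^ N \<and> c + e * N < D"
proof -
  define e' where "e' = Suc e"
  have "\<exists>N0. \<forall>N\<ge>N0. real k * (real c + real e' * (real N + 1)) \<le> 2 ^ N"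
  proof -
    have l: "(\<lambda>N. real k * (real c + real e' * (real N + 1)) / 2 ^ N) \<longlonglongrightarrow> 0"
      by real_asymp
    have "eventually (\<lambda>N. real k * (real c + real e' * (real N + 1)) / 2 ^ N < 1) sequentially"
      using order_tendstoD(2)[OF l, of 1] by simp
    then show ?thesis unfolding eventually_sequentially
      by (auto simp: field_simps intro!: less_imp_le)
  qed
  then obtain N0 where N0: "\<And>N. N \<ge> N0 \<Longrightarrow> real k * (real c + real e' * (real N + 1)) \<le> 2 ^ N"
    by blast
  have "\<exists>N. k * D \<le> 2 ^ N \<and> c + e * N < D" if D: "D > c + e' * N0" for D
  proof -
    \<comment> \<open>The largest \<open>N\<close> for which \<open>c + e' * N\<close> is still
      below \<open>D\<close>; for large \<open>D\<close> its power of two exceeds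
      \<open>k * D\<close>. The successor \<open>e'\<close> of \<open>e\<close> is positive, so the
      division makes sense.\<close>
    define N where "N = (D - c - 1) div e'"
    have "e' * N \<le> D - c - 1" unfolding N_def by simp
    then have 1: "c + e' * N < D" using D by linarith
    have "D - c - 1 < e' * (N + 1)" unfolding N_def e'_def
      by (metis Suc_eq_plus1 dividend_less_div_times mult.commute mult_Suc_right zero_less_Suc)
    then have 2: "D \<le> c + e' * (N + 1)" by linarith
    have "N0 \<le> N" 
    proof -
      have "e' * N0 \<le> D - c - 1" using D by linarith
      then have "e' * N0 div e' \<le> N" unfolding N_def by (rule div_le_mono)
      then show ?thesis using nonzero_mult_div_cancel_left[of e' N0] unfolding e'_def by simp
    qed
    then have "real (k * (c + e' * (N + 1))) \<le> real (2 ^ N)" using N0[of N] by (simp add: algebra_simps)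
    then have "k * (c + e' * (N + 1)) \<le> 2 ^ N" unfolding of_nat_le_iff .
    then have "k * D \<le> 2 ^ N" using mult_le_mono2[OF 2, of k] by linarith
    moreover have "c + e * N < D" using 1 unfolding e'_def by simp
    ultimately show ?thesis by blast
  qed
  then show ?thesis by blast
qed

text \<open>Take \<open>q\<close> in the interval at the greatest distance \<open>D\<close> from the
  path. Points at distance \<open>2 * D\<close> on its two sides (or the endpoints, if nearer) are
  again within \<open>D\<close> of the path. The path points found there are at most
  \<open>6 * D\<close> apart, so \<open>q\<close> is within a logarithm of \<open>D\<close> of the
  path, which bounds \<open>D\<close>.\<close>

lemma interval_near_quasi_geodesic:
  "\<exists>D. \<forall>P n p. quasi_geodesic M K P n \<and> btw (P 0) p (P n) \<longrightarrow> (\<exists>j\<le>n. d p (P j) \<le> D)"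
proof -
  obtain D0 where D0: "\<And>D. D > D0 \<Longrightarrow> \<exists>N. (6 * K) * D \<le> 2 ^ N \<and> (2 * \<delta> + M) + \<delta> * N < D"
    using ex_exponent[of "6 * K" "2 * \<delta> + M" \<delta>] by blast
  have "\<exists>j\<le>n. d p (P j) \<le> max D0 (2 * \<delta>)" if P: "quasi_geodesic M K P n" and p: "btw (P 0) p (P n)"
    for P n p
  proof (rule ccontr)
    assume neg: "\<not> ?thesis"
    have PX: "P i \<in> U" if "i \<le> n" for i using P that unfolding quasi_geodesic_def by blast
    define f where "f q = (LEAST D. \<exists>j\<le>n. d q (P j) \<le> D)" for q
    have f_ex: "\<exists>j\<le>n. d q (P j) \<le> f q" for q
      unfolding f_def by (rule LeastI_ex) auto
    have f_least: "f q \<le> d q (P j)" if "j \<le> n" for q j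
      unfolding f_def using that by (intro Least_le) auto
    have bound: "f q \<le> d (P 0) (P n)" if "btw (P 0) q (P n)" for q
    proof -
      have "d q (P n) \<le> d (P 0) (P n)" using that unfolding btw_def by linarith
      then show ?thesis using f_least[of n q] by linarith
    qed
    \<comment> \<open>The interval may be infinite, but distances to the path are bounded on it, so
      the maximum is over a finite set of numbers.\<close>
    define D where "D = Max (f ` {q. btw (P 0) q (P n)})"
    have fin: "finite (f ` {q. btw (P 0) q (P n)})"
      by (rule finite_subset[of _ "{..d (P 0) (P n)}"]) (use bound in auto)
    have "D \<in> f ` {q. btw (P 0) q (P n)}"
      unfolding D_def using p by (intro Max_in fin) auto
    then obtain q where q: "btw (P 0) q (P n)" "f q = D" by auto
    have Dmax: "f r \<le> D" if "btw (P 0) r (P n)" for r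
      unfolding D_def using that fin by (intro Max_ge) auto
    have "D > max D0 (2 * \<delta>)"
      using f_ex[of p] neg Dmax[OF p] by (meson le_trans not_le)
    then have D: "D > D0" "D > 2 * \<delta>" by auto
    then obtain N where N: "6 * K * D \<le> 2 ^ N" "2 * \<delta> + M + \<delta> * N < D" using D0 by blast
    have qX: "q \<in> U" using q unfolding btw_def by blast
    have far: "D \<le> d q (P j)" if "j \<le> n" for j using f_least that q(2) by blast
    \<comment> \<open>Walk a distance \<open>2 D\<close> from \<open>q\<close> towards an endpoint (or up to the endpoint), then jump to \<open>P\<close>.\<close>
    have side: "\<exists>y a. btw q y (P e) \<and> d q y \<le> 2 * D \<and> a \<le> n \<and> d y (P a) \<le> D \<and>
        (\<forall>r. btw y r (P a) \<longrightarrow> D \<le> d q r)"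
      if e: "e \<le> n" and qe: "btw (P e') q (P e)" "{e, e'} = {0, n}" for e e'
    proof (cases "d q (P e) \<le> 2 * D")
      case True
      have "D \<le> d q r" if "btw (P e) r (P e)" for r
      proof -
        have r: "r \<in> U" "d r (P e) = 0"
          using that dist_refl[of "P e"] unfolding btw_def by auto
        have "d q (P e) \<le> d q r" using dist_tri[of q r "P e"] qX r PX[OF e] by simp
        then show ?thesis using far[OF e] by linarith
      qed
      then show ?thesis using True e PX[OF e] qX dist_refl
        by (intro exI[of _ "P e"] exI[of _ e]) (auto simp: btw_def)
    next
      case False
      then obtain y where y: "y \<in> U" "d q y = 2 * D" "2 * D + d y (P e) = d q (P e)"
        using geodesic[of q "P e" "2 * D"] qX PX[OF e] by auto
      have b: "btw q y (P e)" using y qX PX[OF e] unfolding btw_def by simp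
      have "btw (P e) y (P e')" using btw_left_trans[OF btw_sym[OF qe(1)] btw_sym[OF b]] by blast
      then have "btw (P 0) y (P n)" using qe(2) btw_sym by (auto simp: doubleton_eq_iff)
      then obtain a where a: "a \<le> n" "d y (P a) \<le> D" using f_ex[of y] Dmax[of y] by (meson le_trans)
      have "D \<le> d q r" if "btw y r (P a)" for r
      proof -
        have "r \<in> U" "d y r \<le> D" using that a unfolding btw_def by auto
        then show ?thesis using dist_tri[of q r y] dist_sym[of y r] y qX by simp
      qed
      then show ?thesis using b y(2) a by (intro exI[of _ y] exI[of _ a]) simp
    qed
    obtain y a where y: "btw q y (P 0)" "d q y \<le> 2 * D" "a \<le> n" "d y (P a) \<le> D"
        "\<And>r. btw y r (P a) \<Longrightarrow> D \<le> d q r"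
      using side[of 0 n] btw_sym[OF q(1)] by blast
    obtain z b where z: "btw q z (P n)" "d q z \<le> 2 * D" "b \<le> n" "d z (P b) \<le> D"
        "\<And>r. btw z r (P b) \<Longrightarrow> D \<le> d q r"
      using side[of n 0] q(1) by auto
    have yX: "y \<in> U" "z \<in> U" "P a \<in> U" "P b \<in> U" using y z PX unfolding btw_def by auto
    \<comment> \<open>The quadrilateral \<open>y\<close>, \<open>P a\<close>, \<open>P b\<close>,
      \<open>z\<close> is cut by the diagonal from \<open>y\<close> to \<open>P b\<close>. Each
      triangle costs \<open>\<delta>\<close>, and the sides from \<open>y\<close> to
      \<open>P a\<close> and from \<open>z\<close> to \<open>P b\<close> stay at distance at least
      \<open>D\<close>, more than \<open>2 * \<delta>\<close>, from \<open>q\<close>. Only the side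
      between the path points remains.\<close>
    have "btw y q z" using btw_middle[OF q(1) btw_sym[OF y(1)] z(1)] .
    then obtain r1 where r1: "btw y r1 (P b) \<or> btw (P b) r1 z" "d q r1 \<le> \<delta>"
      using btw_slim yX by blast
    have r1X: "r1 \<in> U" using r1 unfolding btw_def by blast
    have "btw y r1 (P b)" using r1 z(5)[of r1] btw_sym D by fastforce
    then obtain r2 where r2: "btw y r2 (P a) \<or> btw (P a) r2 (P b)" "d r1 r2 \<le> \<delta>"
      using btw_slim yX by blast
    have r2X: "r2 \<in> U" using r2 unfolding btw_def by blast
    have qr2: "d q r2 \<le> 2 * \<delta>" using dist_tri[of q r1 r2] qX r1X r2X r1 r2 by simp
    then have r2b: "btw (P a) r2 (P b)" using r2 y(5)[of r2] D by fastforce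
    \<comment> \<open>The route over \<open>y\<close>, \<open>q\<close> and \<open>z\<close> has
      length at most \<open>D + 2 * D + 2 * D + D\<close>.\<close>
    have "d (P a) (P b) \<le> d (P a) y + d y q + d q z + d z (P b)"
      using dist_tri[of "P a" y "P b"] dist_tri[of y q "P b"] dist_tri[of q z "P b"] yX qX by linarith
    also have "\<dots> \<le> 6 * D"
      using y z dist_sym[of "P a" y] dist_sym[of y q] yX qX by linarith
    finally have "K * d (P a) (P b) \<le> K * (6 * D)" by (rule mult_le_mono2)
    then have "K * d (P a) (P b) \<le> 2 ^ N" using N(1) by (simp only: mult.left_commute mult.assoc)
    then obtain j where j: "j \<le> n" "d r2 (P j) \<le> \<delta> * N + M"
      using exponential_divergence_quasi[OF P y(3) z(3) r2b] by blast
    have "d q (P j) \<le> 2 * \<delta> + \<delta> * N + M"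
      using dist_tri[of q r2 "P j"] qX r2X PX[OF j(1)] j qr2 by linarith
    then show False using far[OF j(1)] N by linarith
  qed
  then show ?thesis by blast
qed

lemma quasi_geodesic_lipschitz:
  assumes "quasi_geodesic M K P n" "i \<le> j" "j \<le> n"
  shows "d (P i) (P j) \<le> M * (j - i)"
  using assms(2,3)
proof (induction j rule: dec_induct)
  case base
  then show ?case using assms dist_refl unfolding quasi_geodesic_def by auto
next
  case (step j)
  have "d (P i) (P (Suc j)) \<le> d (P i) (P j) + d (P j) (P (Suc j))"
    using assms step unfolding quasi_geodesic_def by (intro dist_tri) auto
  also have "\<dots> \<le> M * (j - i) + M"
    using assms step unfolding quasi_geodesic_def by (intro add_mono) auto
  finally show ?case using step by (simp add: Suc_diff_le)
qed

text \<open>Every point of the interval is near the part of the path before \<open>j\<close> or the part after \<open>j\<close>;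
  by connectedness some point is near both, and then these parts are short in between.\<close>
lemma quasi_geodesic_near_interval:
  "\<exists>D. \<forall>P n j. quasi_geodesic M K P n \<and> j \<le> n \<longrightarrow> (\<exists>p. btw (P 0) p (P n) \<and> d (P j) p \<le> D)"
proof -
  obtain D where D: "\<And>P n p. quasi_geodesic M K P n \<Longrightarrow> btw (P 0) p (P n) \<Longrightarrow> \<exists>j\<le>n. d p (P j) \<le> D"
    using interval_near_quasi_geodesic by blast
  have "\<exists>p. btw (P 0) p (P n) \<and> d (P j) p \<le> M * (K * (2 * D + 1)) + D"
    if P: "quasi_geodesic M K P n" and j: "j \<le> n" for P n j
  proof -
    have PX: "P i \<in> U" if "i \<le> n" for i using P that unfolding quasi_geodesic_def by blast
    \<comment> \<open>The point \<open>p\<close> of \<open>B\<close> farthest from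
      \<open>P 0\<close> has a successor on the interval that is near no index up to
      \<open>j\<close>, hence near a later one; the unit step to it turns \<open>D\<close> into
      \<open>D + 1\<close>.\<close>
    define B where "B = {p. btw (P 0) p (P n) \<and> (\<exists>a\<le>j. d p (P a) \<le> D)}"
    have "P 0 \<in> B" unfolding B_def btw_def using PX dist_refl by auto
    moreover have "\<forall>p. p \<in> B \<longrightarrow> d (P 0) p < Suc (d (P 0) (P n))" unfolding B_def btw_def by auto
    ultimately obtain p where p: "p \<in> B" and pmax: "\<And>p'. p' \<in> B \<Longrightarrow> d (P 0) p' \<le> d (P 0) p"
      using ex_has_greatest_nat[of "\<lambda>p. p \<in> B" "P 0" "\<lambda>p. d (P 0) p" "Suc (d (P 0) (P n))"] by auto
    obtain a where a: "a \<le> j" "d p (P a) \<le> D" and pb: "btw (P 0) p (P n)" using p unfolding B_def by blast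
    have pX: "p \<in> U" using pb unfolding btw_def by blast
    have "\<exists>b. j \<le> b \<and> b \<le> n \<and> d p (P b) \<le> D + 1"
    proof (cases "d p (P n) = 0")
      case True then show ?thesis using j by auto
    next
      case False
      then obtain p' where p': "p' \<in> U" "d p p' = 1" "1 + d p' (P n) = d p (P n)"
        using geodesic[of p "P n" 1] pX PX by auto
      have "btw p p' (P n)" using p' pX PX unfolding btw_def by simp
      then have b': "btw (P 0) p' (P n)"
        using btw_left_trans[OF btw_sym[OF pb]] btw_sym by blast
      then have "d (P 0) p' > d (P 0) p" using pb p' unfolding btw_def by linarith
      then have "p' \<notin> B" using pmax by fastforce
      moreover obtain b where b: "b \<le> n" "d p' (P b) \<le> D" using D[OF P b'] by blast
      ultimately have "\<not> b \<le> j" using b' unfolding B_def by blast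
      then have "j \<le> b" by simp
      moreover have "d p (P b) \<le> D + 1" using dist_tri[of p p' "P b"] pX p' PX b by simp
      ultimately show ?thesis using b by blast
    qed
    then obtain b where b: "j \<le> b" "b \<le> n" "d p (P b) \<le> D + 1" by blast
    have U: "P a \<in> U" "P b \<in> U" "P j \<in> U" using PX a b j by auto
    \<comment> \<open>\<open>P a\<close> and \<open>P b\<close> are both near \<open>p\<close>, and
      \<open>j\<close> lies between \<open>a\<close> and \<open>b\<close>; the lower quasi-geodesic
      bound limits \<open>j - a\<close>, and the step bound then limits
      \<open>d (P a) (P j)\<close>.\<close>
    have "d (P a) (P b) \<le> 2 * D + 1"
      using dist_tri[of "P a" p "P b"] dist_sym[of "P a" p] U pX a b by linarith
    moreover have "b - a \<le> K * d (P a) (P b)" using P a b unfolding quasi_geodesic_def by auto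
    ultimately have "j - a \<le> K * (2 * D + 1)"
      using mult_le_mono2[of "d (P a) (P b)" "2 * D + 1" K] b by linarith
    then have "d (P a) (P j) \<le> M * (K * (2 * D + 1))"
      using quasi_geodesic_lipschitz[OF P a(1) j] by (meson le_trans mult_le_mono2)
    then have "d (P j) p \<le> M * (K * (2 * D + 1)) + D"
      using dist_tri[of "P j" "P a" p] dist_sym[of "P j" "P a"] dist_sym[of "P a" p] U pX a by linarith
    then show ?thesis using pb by blast
  qed
  then show ?thesis by blast
qed

section \<open>Centres of triangles\<close>

text \<open>\<open>c\<close> is the point of the side from \<open>x\<close> to \<open>y\<close>
  farthest from \<open>x\<close> that is still within \<open>\<delta>\<close> of the side from
  \<open>x\<close> to \<open>z\<close>. Its successor must be near the third side, whence the extra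
  \<open>1\<close> in the second bound only.\<close>

lemma triangle_center:
  assumes "x \<in> U" "y \<in> U" "z \<in> U"
  shows "\<exists>c p q. btw x c y \<and> btw x p z \<and> btw z q y \<and> d c p \<le> \<delta> \<and> d c q \<le> \<delta> + 1"
proof -
  define B where "B = {p. btw x p y \<and> (\<exists>q. btw x q z \<and> d p q \<le> \<delta>)}"
  have "x \<in> B" unfolding B_def btw_def using assms dist_refl by (auto intro!: exI[of _ x])
  moreover have "\<forall>p. p \<in> B \<longrightarrow> d x p < Suc (d x y)" unfolding B_def btw_def by auto
  ultimately obtain c where c: "c \<in> B" and cmax: "\<And>p'. p' \<in> B \<Longrightarrow> d x p' \<le> d x c"
    using ex_has_greatest_nat[of "\<lambda>p. p \<in> B" x "d x" "Suc (d x y)"] by auto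
  obtain p where p: "btw x p z" "d c p \<le> \<delta>" and cb: "btw x c y" using c unfolding B_def by blast
  have cX: "c \<in> U" using cb unfolding btw_def by blast
  have "\<exists>q. btw z q y \<and> d c q \<le> \<delta> + 1"
  proof (cases "d c y = 0")
    case True then show ?thesis using assms dist_refl by (auto simp: btw_def intro!: exI[of _ y])
  next
    case False
    then obtain p' where p': "p' \<in> U" "d c p' = 1" "1 + d p' y = d c y"
      using geodesic[of c y 1] cX assms by auto
    have "btw c p' y" using p' cX assms unfolding btw_def by simp
    then have b': "btw x p' y" using btw_left_trans[OF btw_sym[OF cb]] btw_sym by blast
    then have "d x p' > d x c" using cb p' unfolding btw_def by linarith
    then have "p' \<notin> B" using cmax by fastforce
    then obtain q where q: "btw z q y" "d p' q \<le> \<delta>"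
      using btw_slim[OF b' assms(3)] b' unfolding B_def by blast
    have "d c q \<le> \<delta> + 1" using dist_tri[of c p' q] cX p' q unfolding btw_def by auto
    then show ?thesis using q by blast
  qed
  then show ?thesis using cb p by blast
qed

end

section \<open>Word metrics\<close>

context group
begin

text \<open>The empty word may represent the identity, unlike in
  \<open>semigroup_generating_set\<close>; so symmetric generating sets qualify too, even the empty
  one of the trivial group.\<close>

definition word_generating_set :: "'a set \<Rightarrow> bool" where
  "word_generating_set S \<longleftrightarrow>
     S \<subseteq> carrier G \<and> (\<forall>g \<in> carrier G. \<exists>w \<in> lists S. eval_word G w = g)"

lemma eval_word_Nil [simp]: "eval_word G [] = \<one>"
  by (simp add: eval_word_def)

lemma eval_word_Cons [simp]: "eval_word G (a # w) = a \<otimes> eval_word G w"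
  by (simp add: eval_word_def)

lemma eval_word_closed [simp]: "set w \<subseteq> carrier G \<Longrightarrow> eval_word G w \<in> carrier G"
  by (induction w) auto

lemma eval_word_append:
  "set u \<subseteq> carrier G \<Longrightarrow> set w \<subseteq> carrier G \<Longrightarrow>
     eval_word G (u @ w) = eval_word G u \<otimes> eval_word G w"
  by (induction u) (auto simp: m_assoc)

lemma lists_carrier:
  "word_generating_set S \<Longrightarrow> w \<in> lists S \<Longrightarrow> set w \<subseteq> carrier G"
  unfolding word_generating_set_def by (auto dest: in_listsD)

lemma word_length_witness:
  assumes "word_generating_set S" "g \<in> carrier G"
  shows "\<exists>w \<in> lists S. length w = word_length G S g \<and> eval_word G w = g"
proof -
  have "\<exists>n. \<exists>w \<in> lists S. length w = n \<and> eval_word G w = g"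
    using assms unfolding word_generating_set_def by blast
  then show ?thesis unfolding word_length_def by (rule LeastI_ex)
qed

lemma word_length_le: "w \<in> lists S \<Longrightarrow> word_length G S (eval_word G w) \<le> length w"
  unfolding word_length_def by (rule Least_le) blast

lemma word_length_one [simp]: "word_length G S \<one> = 0"
  using word_length_le[of "[]" S] by simp

lemma word_length_mult:
  assumes S: "word_generating_set S" and "g \<in> carrier G" "h \<in> carrier G"
  shows "word_length G S (g \<otimes> h) \<le> word_length G S g + word_length G S h"
proof -
  obtain u where u: "u \<in> lists S" "length u = word_length G S g" "eval_word G u = g"
    using word_length_witness[OF S] assms by blast
  obtain w where w: "w \<in> lists S" "length w = word_length G S h" "eval_word G w = h"
    using word_length_witness[OF S] assms by blast
  show ?thesis
    using word_length_le[of "u @ w" S] eval_word_append lists_carrier[OF S] u w by auto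
qed

lemma word_length_compare:
  assumes A: "word_generating_set A" "finite A" and S: "word_generating_set S"
  shows "\<exists>K. \<forall>g \<in> carrier G. word_length G S g \<le> K * word_length G A g"
proof -
  \<comment> \<open>The inserted 0 keeps \<open>Max\<close> meaningful when \<open>A\<close> is
    empty.\<close>
  define K where "K = Max (insert 0 (word_length G S ` A))"
  have K: "word_length G S a \<le> K" if "a \<in> A" for a
    unfolding K_def using A that by (intro Max_ge) auto
  have "word_length G S (eval_word G w) \<le> K * length w" if "w \<in> lists A" for w
    using that
  proof (induction w)
    case (Cons a w)
    have c: "a \<in> carrier G" "eval_word G w \<in> carrier G"
      using Cons A(1) lists_carrier[OF A(1), of w] unfolding word_generating_set_def by auto
    show ?case using word_length_mult[OF S c] K[OF Cons(1)] Cons(3) by simp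
  qed simp
  then show ?thesis using word_length_witness[OF A(1)] by metis
qed

lemma finite_word_ball:
  assumes "word_generating_set A" "finite A"
  shows "finite {g \<in> carrier G. word_length G A g \<le> n}"
proof (rule finite_subset)
  show "{g \<in> carrier G. word_length G A g \<le> n} \<subseteq>
      eval_word G ` {w. set w \<subseteq> A \<and> length w \<le> n}"
    using word_length_witness[OF assms(1)] by (fastforce simp: lists_eq_set image_iff)
  show "finite (eval_word G ` {w. set w \<subseteq> A \<and> length w \<le> n})"
    using finite_lists_length_le[OF assms(2)] by blast
qed

lemma inv_eval_word:
  assumes "S \<subseteq> carrier G" "w \<in> lists S"
  shows "inv (eval_word G w) = eval_word G (rev (map (m_inv G) w))"
  using assms(2)
proof (induction w)
  case (Cons a w)
  have w: "a \<in> carrier G" "set w \<subseteq> carrier G" using Cons assms(1) by auto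
  then have "set (rev (map (m_inv G) w)) \<subseteq> carrier G" by auto
  then show ?case using Cons w by (simp add: inv_mult_group eval_word_append)
qed simp

lemma set_inv_set_inv: "S \<subseteq> carrier G \<Longrightarrow> set_inv (set_inv S) = S"
  unfolding SET_INV_def by (force simp: subset_iff)

lemma map_inv_lists: "w \<in> lists S \<Longrightarrow> rev (map (m_inv G) w) \<in> lists (set_inv S)"
  unfolding SET_INV_def by (auto simp: in_lists_conv_set)

lemma word_generating_set_set_inv:
  assumes "word_generating_set S"
  shows "word_generating_set (set_inv S)"
  unfolding word_generating_set_def
proof (intro conjI ballI)
  have S: "S \<subseteq> carrier G" using assms unfolding word_generating_set_def by blast
  then show "set_inv S \<subseteq> carrier G" unfolding SET_INV_def by auto
  fix g assume g: "g \<in> carrier G"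
  then obtain w where "w \<in> lists S" "eval_word G w = inv g"
    using assms unfolding word_generating_set_def by (meson inv_closed)
  then show "\<exists>w\<in>lists (set_inv S). eval_word G w = g"
    using inv_eval_word[OF S] map_inv_lists g by (metis inv_inv)
qed

text \<open>Inverting and reversing turns an \<open>S\<close>-word for \<open>inv g\<close> into a
  \<open>set_inv S\<close>-word for \<open>g\<close>. One inequality suffices, since
  \<open>set_inv\<close> is an involution on subsets of the group.\<close>

lemma word_length_set_inv:
  assumes S: "word_generating_set S" and g: "g \<in> carrier G"
  shows "word_length G (set_inv S) g = word_length G S (inv g)"
proof -
  have *: "word_length G (set_inv S) g \<le> word_length G S (inv g)"
    if S: "word_generating_set S" and g: "g \<in> carrier G" for S g
  proof -
    have c: "S \<subseteq> carrier G" using S unfolding word_generating_set_def by blast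
    obtain w where w: "w \<in> lists S" "length w = word_length G S (inv g)" "eval_word G w = inv g"
      using word_length_witness[OF S] g by (meson inv_closed)
    show ?thesis
      using word_length_le[OF map_inv_lists[OF w(1)]] inv_eval_word[OF c w(1)] w g by simp
  qed
  have "word_length G (set_inv (set_inv S)) (inv g) \<le> word_length G (set_inv S) (inv (inv g))"
    using *[OF word_generating_set_set_inv[OF S]] g by blast
  moreover have "set_inv (set_inv S) = S"
    using S set_inv_set_inv unfolding word_generating_set_def by blast
  ultimately show ?thesis using *[OF S g] g by simp
qed

text \<open>Inverses of letters are letters, so the group generated by \<open>A\<close> is already
  the monoid generated by it.\<close>

lemma symmetric_generating_setD:
  assumes "symmetric_generating_set G A"
  shows "finite A" "word_generating_set A" "set_inv A = A"
proof -
  show "finite A" "set_inv A = A" using assms unfolding symmetric_generating_set_def by auto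
  have A: "A \<subseteq> carrier G" using assms unfolding symmetric_generating_set_def by auto
  have "\<exists>w\<in>lists A. eval_word G w = g" if "g \<in> generate G A" for g
    using that
  proof induction
    case one then show ?case by (intro bexI[of _ "[]"]) auto
  next
    case (incl h) then show ?case using A by (intro bexI[of _ "[h]"]) auto
  next
    case (inv h) 
    then have "inv h \<in> A" using \<open>set_inv A = A\<close> unfolding SET_INV_def by blast
    then show ?case using A inv by (intro bexI[of _ "[inv h]"]) auto
  next
    case (eng h1 h2)
    then obtain u w where "u \<in> lists A" "eval_word G u = h1" "w \<in> lists A" "eval_word G w = h2"
      by blast
    moreover have "set u \<subseteq> carrier G" "set w \<subseteq> carrier G"
      using calculation A by auto
    ultimately show ?case using eval_word_append by (intro bexI[of _ "u @ w"]) auto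
  qed
  then show "word_generating_set A"
    using assms A unfolding symmetric_generating_set_def word_generating_set_def by auto
qed

section \<open>The directed word metric and its geodesics\<close>

lemma mult_inv_cancel_left [simp]:
  "x \<in> carrier G \<Longrightarrow> y \<in> carrier G \<Longrightarrow> x \<otimes> (inv x \<otimes> y) = y"
  "x \<in> carrier G \<Longrightarrow> y \<in> carrier G \<Longrightarrow> inv x \<otimes> (x \<otimes> y) = y"
  by (simp_all flip: m_assoc)

lemma word_dist_refl: "x \<in> carrier G \<Longrightarrow> word_dist G S x x = 0"
  by (simp add: word_dist_def)

lemma word_dist_triangle:
  assumes "word_generating_set S" "x \<in> carrier G" "y \<in> carrier G" "z \<in> carrier G"
  shows "word_dist G S x z \<le> word_dist G S x y + word_dist G S y z"
proof -
  have "inv x \<otimes> z = (inv x \<otimes> y) \<otimes> (inv y \<otimes> z)"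
    using assms by (simp add: m_assoc)
  then show ?thesis unfolding word_dist_def using word_length_mult assms by simp
qed

lemma word_dist_left_invariant:
  assumes "g \<in> carrier G" "x \<in> carrier G" "y \<in> carrier G"
  shows "word_dist G S (g \<otimes> x) (g \<otimes> y) = word_dist G S x y"
proof -
  have "inv (g \<otimes> x) \<otimes> (g \<otimes> y) = inv x \<otimes> y"
    using assms by (simp add: inv_mult_group m_assoc)
  then show ?thesis unfolding word_dist_def by simp
qed

lemma word_dist_one: "x \<in> carrier G \<Longrightarrow> word_dist G S \<one> x = word_length G S x"
  by (simp add: word_dist_def)

lemma word_dist_mult:
  "g \<in> carrier G \<Longrightarrow> h \<in> carrier G \<Longrightarrow> word_dist G S g (g \<otimes> h) = word_length G S h"
  using word_dist_left_invariant[of g \<one> h] by (simp add: word_dist_one)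

lemma word_dist_set_inv:
  assumes "word_generating_set S" "x \<in> carrier G" "y \<in> carrier G"
  shows "word_dist G (set_inv S) x y = word_dist G S y x"
  using word_length_set_inv[OF assms(1), of "inv x \<otimes> y"] assms
  unfolding word_dist_def by (simp add: inv_mult_group)

lemma word_dist_sym:
  assumes "symmetric_generating_set G A" "x \<in> carrier G" "y \<in> carrier G"
  shows "word_dist G A x y = word_dist G A y x"
  using word_dist_set_inv[OF symmetric_generating_setD(2)[OF assms(1)] assms(2,3)]
    symmetric_generating_setD(3)[OF assms(1)] by simp

text \<open>Subwords of a shortest word are shortest: otherwise the triangle inequality would
  shorten the whole word.\<close>

lemma cayley_geodesic_of_word:
  assumes S: "word_generating_set S" and x: "x \<in> carrier G" and w: "w \<in> lists S"
    and len: "length w = word_length G S (eval_word G w)"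
  shows "cayley_geodesic G S (\<lambda>i. x \<otimes> eval_word G (take i w)) (length w) x (x \<otimes> eval_word G w)"
proof -
  have tl: "take i w \<in> lists S" "drop i w \<in> lists S" for i 
    using w by (auto dest: in_set_takeD in_set_dropD)
  have c: "eval_word G (take i w) \<in> carrier G" for i
    using lists_carrier[OF S tl(1)] by simp
  have "word_dist G S (x \<otimes> eval_word G (take i w)) (x \<otimes> eval_word G (take j w)) = j - i"
    if ij: "i \<le> j" "j \<le> length w" for i j
  proof -
    define v where "v = take (j - i) (drop i w)"
    have v: "v \<in> lists S" unfolding v_def using w by (auto dest!: in_set_takeD in_set_dropD)
    have tj: "take j w = take i w @ v"
      unfolding v_def using ij by (metis le_add_diff_inverse take_add)
    then have wv: "w = take i w @ v @ drop j w" by (metis append.assoc append_take_drop_id)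
    have sets: "set (take i w) \<subseteq> carrier G" "set v \<subseteq> carrier G" "set (drop j w) \<subseteq> carrier G"
      using lists_carrier[OF S] tl v by blast+
    have "word_dist G S (x \<otimes> eval_word G (take i w)) (x \<otimes> eval_word G (take j w))
        = word_length G S (eval_word G v)"
      using sets x by (simp add: word_dist_left_invariant tj eval_word_append word_dist_mult)
    moreover have "word_length G S (eval_word G v) \<le> j - i"
      using word_length_le[OF v] ij unfolding v_def by simp
    moreover have "j - i \<le> word_length G S (eval_word G v)"
    proof -
      have c: "eval_word G (take i w) \<in> carrier G" "eval_word G v \<in> carrier G"
          "eval_word G (drop j w) \<in> carrier G"
        using sets by auto
      have "eval_word G w = eval_word G (take i w @ v @ drop j w)"
        by (rule arg_cong[OF wv])
      also have "\<dots> = eval_word G (take i w) \<otimes> (eval_word G v \<otimes> eval_word G (drop j w))"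
        using sets by (simp add: eval_word_append)
      finally have "length w =
          word_length G S (eval_word G (take i w) \<otimes> (eval_word G v \<otimes> eval_word G (drop j w)))"
        using len by metis
      then have "length w \<le> word_length G S (eval_word G (take i w)) +
          (word_length G S (eval_word G v) + word_length G S (eval_word G (drop j w)))"
        using word_length_mult[OF S c(1) m_closed[OF c(2,3)]] word_length_mult[OF S c(2,3)]
        by linarith
      then show ?thesis
        using word_length_le[OF tl(1), of i] word_length_le[OF tl(2), of j] ij by simp
    qed
    ultimately show ?thesis by simp
  qed
  then show ?thesis unfolding cayley_geodesic_def using x c by simp
qed

lemma cayley_geodesic_through:
  assumes S: "word_generating_set S" and "x \<in> carrier G" "p \<in> carrier G" "y \<in> carrier G"
    and btw: "word_dist G S x p + word_dist G S p y = word_dist G S x y"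
  shows "\<exists>P. cayley_geodesic G S P (word_dist G S x y) x y \<and> P (word_dist G S x p) = p"
proof -
  obtain u where u: "u \<in> lists S" "length u = word_dist G S x p" "eval_word G u = inv x \<otimes> p"
    using word_length_witness[OF S, of "inv x \<otimes> p"] assms unfolding word_dist_def by auto
  obtain w where w: "w \<in> lists S" "length w = word_dist G S p y" "eval_word G w = inv p \<otimes> y"
    using word_length_witness[OF S, of "inv p \<otimes> y"] assms unfolding word_dist_def by auto
  have e: "eval_word G (u @ w) = inv x \<otimes> y"
    using u w lists_carrier[OF S] assms by (simp add: eval_word_append m_assoc)
  have len: "length (u @ w) = word_dist G S x y" using u w btw by simp
  have "cayley_geodesic G S (\<lambda>i. x \<otimes> eval_word G (take i (u @ w))) (length (u @ w)) x
      (x \<otimes> eval_word G (u @ w))"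
    using u(1) w(1) len e assms unfolding word_dist_def
    by (intro cayley_geodesic_of_word) (auto simp del: eval_word_closed)
  moreover have "x \<otimes> eval_word G (u @ w) = y" "x \<otimes> eval_word G (take (length u) (u @ w)) = p"
    using e u(3) assms by simp_all
  ultimately show ?thesis using len u(2) by metis
qed

lemma cayley_geodesic_btw:
  assumes "cayley_geodesic G S P n x y" "i \<le> n"
  shows "word_dist G S x (P i) + word_dist G S (P i) y = word_dist G S x y"
proof -
  have d: "word_dist G S (P i) (P j) = j - i" if "i \<le> j" "j \<le> n" for i j
    using assms(1) that unfolding cayley_geodesic_def by blast
  have "P 0 = x" "P n = y" using assms(1) unfolding cayley_geodesic_def by auto
  then show ?thesis using d[of 0 i] d[of i n] d[of 0 n] assms(2) by simp
qed

text \<open>A given point of the interval is put on a geodesic through it, so that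
  \<open>slim_triangles\<close> applies; the nearby point found on another side lies in the interval
  of that side.\<close>

lemma slim_metric_word_dist:
  assumes A: "symmetric_generating_set G A" and sl: "slim_triangles G A \<delta>"
  shows "slim_metric (carrier G) (word_dist G A) \<delta>"
proof
  note gen = symmetric_generating_setD(2)[OF A]
  fix x y assume xy: "x \<in> carrier G" "y \<in> carrier G"
  show "word_dist G A x y = word_dist G A y x" using word_dist_sym[OF A] xy .
  obtain P where P: "cayley_geodesic G A P (word_dist G A x y) x y"
    using cayley_geodesic_through[OF gen, of x x y] xy word_dist_refl by auto
  show "\<exists>p\<in>carrier G. word_dist G A x p = t \<and> t + word_dist G A p y = word_dist G A x y"
    if "t \<le> word_dist G A x y" for t
    using P that cayley_geodesic_btw[OF P that] unfolding cayley_geodesic_def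
    by (intro bexI[of _ "P t"]) auto
next
  note gen = symmetric_generating_setD(2)[OF A]
  fix x y z p assume c: "x \<in> carrier G" "y \<in> carrier G" "z \<in> carrier G" "p \<in> carrier G"
    and b: "word_dist G A x p + word_dist G A p y = word_dist G A x y"
  obtain P where P: "cayley_geodesic G A P (word_dist G A x y) x y" "P (word_dist G A x p) = p"
    using cayley_geodesic_through[OF gen, of x p y] c b by auto
  obtain Q where Q: "cayley_geodesic G A Q (word_dist G A y z) y z"
    using cayley_geodesic_through[OF gen, of y y z] c word_dist_refl by auto
  obtain R where R: "cayley_geodesic G A R (word_dist G A x z) x z"
    using cayley_geodesic_through[OF gen, of x x z] c word_dist_refl by auto
  have "(\<exists>j\<le>word_dist G A y z. word_dist G A p (Q j) \<le> \<delta>) \<or>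
      (\<exists>j\<le>word_dist G A x z. word_dist G A p (R j) \<le> \<delta>)"
  proof -
    have "word_dist G A x p \<le> word_dist G A x y" using b by linarith
    then show ?thesis
      using sl[unfolded slim_triangles_def, rule_format, OF conjI[OF P(1) conjI[OF Q R]]] P(2)
      by force
  qed
  then show "\<exists>q\<in>carrier G. (word_dist G A x q + word_dist G A q z = word_dist G A x z \<or>
      word_dist G A z q + word_dist G A q y = word_dist G A z y) \<and> word_dist G A p q \<le> \<delta>"
  proof (elim disjE exE conjE)
    fix j assume j: "j \<le> word_dist G A y z" "word_dist G A p (Q j) \<le> \<delta>"
    then have q: "Q j \<in> carrier G" using Q unfolding cayley_geodesic_def by blast
    then have "word_dist G A z (Q j) + word_dist G A (Q j) y = word_dist G A z y"
      using cayley_geodesic_btw[OF Q j(1)] c word_dist_sym[OF A, of y "Q j"]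
        word_dist_sym[OF A, of "Q j" z] word_dist_sym[OF A, of y z] by simp
    then show ?thesis using j q by blast
  next
    fix j assume j: "j \<le> word_dist G A x z" "word_dist G A p (R j) \<le> \<delta>"
    then have "R j \<in> carrier G" using R unfolding cayley_geodesic_def by blast
    then show ?thesis using cayley_geodesic_btw[OF R j(1)] j by blast
  qed
qed (use word_dist_refl word_dist_triangle symmetric_generating_setD(2)[OF A] in auto)

text \<open>\<open>M\<close> bounds the \<open>A\<close>-length of one \<open>S\<close>-step, and
  \<open>K\<close> compares the lengths the other way. Only pairs of an earlier and a later vertex
  occur, so the direction of \<open>S\<close> does no harm.\<close>

lemma cayley_geodesic_quasi_geodesic:
  assumes A: "symmetric_generating_set G A" and sl: "slim_triangles G A \<delta>"
    and S: "word_generating_set S" "finite S"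
  shows "\<exists>M K. \<forall>P n x y. cayley_geodesic G S P n x y \<longrightarrow>
    slim_metric.quasi_geodesic (carrier G) (word_dist G A) M K P n"
proof -
  interpret slim_metric "carrier G" "word_dist G A" \<delta> using slim_metric_word_dist[OF A sl] .
  note gen = symmetric_generating_setD(2)[OF A]
  obtain M where M: "\<And>g. g \<in> carrier G \<Longrightarrow> word_length G A g \<le> M * word_length G S g"
    using word_length_compare[OF S gen] by blast
  obtain K where K: "\<And>g. g \<in> carrier G \<Longrightarrow> word_length G S g \<le> K * word_length G A g"
    using word_length_compare[OF gen _ S(1)] symmetric_generating_setD(1)[OF A] by blast
  have "quasi_geodesic M K P n" if P: "cayley_geodesic G S P n x y" for P n x y
  proof -
    have c: "P i \<in> carrier G" if "i \<le> n" for i using P that unfolding cayley_geodesic_def by blast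
    have d: "word_dist G S (P i) (P j) = j - i" if "i \<le> j" "j \<le> n" for i j
      using P that unfolding cayley_geodesic_def by blast
    have "word_dist G A (P i) (P (Suc i)) \<le> M" if "i < n" for i
      using M[of "inv (P i) \<otimes> P (Suc i)"] d[of i "Suc i"] c[of i] c[of "Suc i"] that
      unfolding word_dist_def by simp
    moreover have "j - i \<le> K * word_dist G A (P i) (P j)" if "i \<le> j" "j \<le> n" for i j
      using K[of "inv (P i) \<otimes> P j"] d[of i j] c[of i] c[of j] that
      unfolding word_dist_def by simp
    ultimately show ?thesis unfolding quasi_geodesic_def using c by blast
  qed
  then show ?thesis by blast
qed

text \<open>Stability of quasi-geodesics is used twice, so that \<open>A\<close> and \<open>S\<close> need not be related to the
  generating set witnessing hyperbolicity.\<close>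
lemma interval_near_geodesic:
  assumes hyp: "word_hyperbolic G"
    and A: "word_generating_set A" "finite A" and S: "word_generating_set S" "finite S"
  shows "\<exists>D. \<forall>x p y P n. p \<in> carrier G \<and> cayley_geodesic G S P n x y \<and>
    word_dist G A x p + word_dist G A p y = word_dist G A x y \<longrightarrow>
    (\<exists>j\<le>n. word_dist G A p (P j) \<le> D)"
proof -
  obtain B \<delta> where B: "symmetric_generating_set G B" "slim_triangles G B \<delta>"
    using hyp unfolding word_hyperbolic_def by blast
  interpret slim_metric "carrier G" "word_dist G B" \<delta> using slim_metric_word_dist[OF B] .
  note gen = symmetric_generating_setD(2)[OF B(1)]
  obtain M K where MK: "\<And>P n x y. cayley_geodesic G A P n x y \<Longrightarrow> quasi_geodesic M K P n"
    using cayley_geodesic_quasi_geodesic[OF B A] by blast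
  obtain M' K' where MK': "\<And>P n x y. cayley_geodesic G S P n x y \<Longrightarrow> quasi_geodesic M' K' P n"
    using cayley_geodesic_quasi_geodesic[OF B S] by blast
  obtain D where D: "\<And>P n j. quasi_geodesic M K P n \<Longrightarrow> j \<le> n \<Longrightarrow>
      \<exists>p. btw (P 0) p (P n) \<and> word_dist G B (P j) p \<le> D"
    using quasi_geodesic_near_interval[of M K] by blast
  obtain D' where D': "\<And>P n p. quasi_geodesic M' K' P n \<Longrightarrow> btw (P 0) p (P n) \<Longrightarrow>
      \<exists>j\<le>n. word_dist G B p (P j) \<le> D'"
    using interval_near_quasi_geodesic[of M' K'] by blast
  obtain C where C: "\<And>g. g \<in> carrier G \<Longrightarrow> word_length G A g \<le> C * word_length G B g"
    using word_length_compare[OF gen _ A(1)] symmetric_generating_setD(1)[OF B(1)] by blast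
  have "\<exists>j\<le>n. word_dist G A p (P j) \<le> C * (D + D')"
    if p: "p \<in> carrier G" and P: "cayley_geodesic G S P n x y"
      and b: "word_dist G A x p + word_dist G A p y = word_dist G A x y" for x p y P n
  proof -
    have c: "x \<in> carrier G" "y \<in> carrier G" and ends: "P 0 = x" "P n = y"
      and Pc: "\<And>i. i \<le> n \<Longrightarrow> P i \<in> carrier G"
      using P unfolding cayley_geodesic_def by auto
    obtain Q where Q: "cayley_geodesic G A Q (word_dist G A x y) x y" "Q (word_dist G A x p) = p"
      using cayley_geodesic_through[OF A(1) c(1) p c(2) b] by blast
    have le: "word_dist G A x p \<le> word_dist G A x y" using b by linarith
    \<comment> \<open>The first use of stability takes \<open>p\<close> from an
      \<open>A\<close>-geodesic to the \<open>B\<close>-interval, the second from there to the given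
      \<open>S\<close>-geodesic.\<close>
    obtain q where q: "btw x q y" "word_dist G B p q \<le> D"
      using D[OF MK[OF Q(1)] le] Q unfolding cayley_geodesic_def by auto
    then obtain j where j: "j \<le> n" "word_dist G B q (P j) \<le> D'"
      using D'[OF MK'[OF P], of q] ends by auto
    have "word_dist G B p (P j) \<le> D + D'"
      using dist_tri[of p q "P j"] p q j Pc unfolding btw_def by fastforce
    then have "word_dist G A p (P j) \<le> C * (D + D')"
      using C[of "inv p \<otimes> P j"] p Pc[OF j(1)] unfolding word_dist_def
      by (meson inv_closed le_trans m_closed mult_le_mono2)
    then show ?thesis using j by blast
  qed
  then show ?thesis by blast
qed

lemma interval_near_interval:
  assumes hyp: "word_hyperbolic G"
    and A: "word_generating_set A" "finite A" and S: "word_generating_set S" "finite S"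
  shows "\<exists>D. \<forall>x p y. x \<in> carrier G \<and> p \<in> carrier G \<and> y \<in> carrier G \<and>
    word_dist G A x p + word_dist G A p y = word_dist G A x y \<longrightarrow>
    (\<exists>q \<in> carrier G. word_dist G S x q + word_dist G S q y = word_dist G S x y \<and> word_dist G A p q \<le> D)"
proof -
  obtain D where D: "\<And>x p y P n. p \<in> carrier G \<Longrightarrow> cayley_geodesic G S P n x y \<Longrightarrow>
    word_dist G A x p + word_dist G A p y = word_dist G A x y \<Longrightarrow>
    \<exists>j\<le>n. word_dist G A p (P j) \<le> D"
    using interval_near_geodesic[OF assms] by blast
  have "\<exists>q \<in> carrier G. word_dist G S x q + word_dist G S q y = word_dist G S x y \<and> word_dist G A p q \<le> D"
    if c: "x \<in> carrier G" "p \<in> carrier G" "y \<in> carrier G"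
      and b: "word_dist G A x p + word_dist G A p y = word_dist G A x y" for x p y
  proof -
    obtain P where P: "cayley_geodesic G S P (word_dist G S x y) x y"
      using cayley_geodesic_through[OF S(1), of x x y] c word_dist_refl by auto
    obtain j where j: "j \<le> word_dist G S x y" "word_dist G A p (P j) \<le> D" using D[OF c(2) P b] by blast
    then show ?thesis using cayley_geodesic_btw[OF P j(1)] P unfolding cayley_geodesic_def by blast
  qed
  then show ?thesis by blast
qed

end

section \<open>Digraphs from finitely many futures\<close>

text \<open>The Myhill--Nerode class of \<open>w\<close> with output: the graph of a partial
  function that sends a continuation of \<open>w\<close> in \<open>L\<close> to the increment of
  \<open>\<phi>\<close>.\<close>

definition futures :: "'a list set \<Rightarrow> ('a list \<Rightarrow> int) \<Rightarrow> 'a list \<Rightarrow> ('a list \<times> int) set" where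
  "futures L \<phi> w = {(u, \<phi> (w @ u) - \<phi> w) | u. w @ u \<in> L}"

lemma in_futures_iff: "(u, n) \<in> futures L \<phi> w \<longleftrightarrow> w @ u \<in> L \<and> n = \<phi> (w @ u) - \<phi> w"
  by (auto simp: futures_def)

text \<open>\<open>c\<close> is an invariant with finitely many values that determines futures; the
  one-sided condition is applied in both orders of \<open>w\<close> and \<open>w'\<close>.\<close>

lemma finite_futuresI:
  assumes "finite (c ` L)"
    and "\<And>w w' u. w \<in> L \<Longrightarrow> w' \<in> L \<Longrightarrow> c w = c w' \<Longrightarrow> w @ u \<in> L \<Longrightarrow>
      w' @ u \<in> L \<and> \<phi> (w' @ u) - \<phi> w' = \<phi> (w @ u) - \<phi> w"
  shows "finite (futures L \<phi> ` L)"
proof -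
  have eq: "futures L \<phi> w = futures L \<phi> w'" if "w \<in> L" "w' \<in> L" "c w = c w'" for w w'
    using assms(2)[OF that] assms(2)[OF that(2,1) that(3)[symmetric]]
    by (auto simp: in_futures_iff set_eq_iff)
  have "futures L \<phi> ` L \<subseteq> (\<lambda>x. futures L \<phi> (SOME w. w \<in> L \<and> c w = x)) ` (c ` L)"
  proof (intro image_subsetI)
    fix w assume w: "w \<in> L"
    define w' where "w' = (SOME w'. w' \<in> L \<and> c w' = c w)"
    have "w' \<in> L \<and> c w' = c w" unfolding w'_def by (rule someI[of _ w]) (use w in simp)
    then have "futures L \<phi> w = futures L \<phi> w'" using eq[OF w, of w'] by metis
    then show "futures L \<phi> w \<in> (\<lambda>x. futures L \<phi> (SOME w. w \<in> L \<and> c w = x)) ` (c ` L)"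
      using w unfolding w'_def by blast
  qed
  then show ?thesis using assms(1) finite_surj by blast
qed

section \<open>Paths in labelled digraphs\<close>

lemma path_reading_unique:
  assumes "labelled_digraph A V v E" "path_reading x E w \<gamma>" "path_reading x E w \<gamma>'"
  shows "\<gamma> = \<gamma>'"
proof (rule nth_equalityI)
  show len: "length \<gamma> = length \<gamma>'" using assms unfolding path_reading_def by simp
  fix i assume "i < length \<gamma>"
  then show "\<gamma> ! i = \<gamma>' ! i"
  proof (induction i)
    case 0 then show ?case using assms unfolding path_reading_def by simp
  next
    case (Suc i)
    then have "i < length w" using assms(2) unfolding path_reading_def by simp
    then have "(\<gamma> ! i, w ! i, \<gamma> ! Suc i) \<in> E" "(\<gamma>' ! i, w ! i, \<gamma>' ! Suc i) \<in> E"
      using assms(2,3) unfolding path_reading_def by blast+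
    then show ?case using Suc assms(1) unfolding labelled_digraph_def by auto
  qed
qed

lemma path_reading_append:
  assumes "path_reading x E w \<gamma>"
  shows "(\<exists>\<gamma>'. path_reading (\<gamma> ! length w) E u \<gamma>') \<longleftrightarrow>
    (\<exists>\<gamma>'. path_reading x E (w @ u) \<gamma>' \<and> take (Suc (length w)) \<gamma>' = \<gamma>)"
proof
  assume "\<exists>\<gamma>'. path_reading (\<gamma> ! length w) E u \<gamma>'"
  then obtain \<gamma>' where \<gamma>': "path_reading (\<gamma> ! length w) E u \<gamma>'" by blast
  have "path_reading x E (w @ u) (\<gamma> @ tl \<gamma>')"
    unfolding path_reading_def
  proof (intro conjI allI impI)
    show "length (\<gamma> @ tl \<gamma>') = Suc (length (w @ u))" "(\<gamma> @ tl \<gamma>') ! 0 = x"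
      using assms \<gamma>' unfolding path_reading_def by (auto simp: nth_append)
    fix i assume i: "i < length (w @ u)"
    have right: "(\<gamma> @ tl \<gamma>') ! (length w + j) = \<gamma>' ! j" if "j \<le> length u" for j
      using assms \<gamma>' that unfolding path_reading_def
      by (cases j) (auto simp: nth_append nth_tl)
    show "((\<gamma> @ tl \<gamma>') ! i, (w @ u) ! i, (\<gamma> @ tl \<gamma>') ! Suc i) \<in> E"
    proof (cases "i < length w")
      case True then show ?thesis using assms unfolding path_reading_def by (simp add: nth_append)
    next
      case False
      then have "(\<gamma>' ! (i - length w), u ! (i - length w), \<gamma>' ! Suc (i - length w)) \<in> E"
        using i \<gamma>' unfolding path_reading_def by simp
      then show ?thesis
        using right[of "i - length w"] right[of "Suc (i - length w)"] False i by (simp add: nth_append)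
    qed
  qed
  moreover have "take (Suc (length w)) (\<gamma> @ tl \<gamma>') = \<gamma>"
    using assms unfolding path_reading_def by simp
  ultimately show "\<exists>\<gamma>'. path_reading x E (w @ u) \<gamma>' \<and> take (Suc (length w)) \<gamma>' = \<gamma>" by blast
next
  assume "\<exists>\<gamma>'. path_reading x E (w @ u) \<gamma>' \<and> take (Suc (length w)) \<gamma>' = \<gamma>"
  then obtain \<gamma>' where \<gamma>': "path_reading x E (w @ u) \<gamma>'" "take (Suc (length w)) \<gamma>' = \<gamma>" by blast
  have len: "length \<gamma>' = Suc (length w + length u)" using \<gamma>' unfolding path_reading_def by simp
  have "path_reading (\<gamma> ! length w) E u (drop (length w) \<gamma>')"
    unfolding path_reading_def
  proof (intro conjI allI impI)
    show "length (drop (length w) \<gamma>') = Suc (length u)" using len by simp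
    show "drop (length w) \<gamma>' ! 0 = \<gamma> ! length w" using len \<gamma>'(2) by (auto simp: nth_take)
    fix i assume "i < length u"
    then have "(\<gamma>' ! (length w + i), (w @ u) ! (length w + i), \<gamma>' ! Suc (length w + i)) \<in> E"
      using \<gamma>'(1) unfolding path_reading_def by (metis length_append nat_add_left_cancel_less)
    then show "(drop (length w) \<gamma>' ! i, u ! i, drop (length w) \<gamma>' ! Suc i) \<in> E"
      using len \<open>i < length u\<close> by simp
  qed
  then show "\<exists>\<gamma>'. path_reading (\<gamma> ! length w) E u \<gamma>'" by blast
qed

lemma path_reading_take:
  assumes "path_reading x E (w @ u) \<gamma>"
  shows "path_reading x E w (take (Suc (length w)) \<gamma>)"
  unfolding path_reading_def
proof (intro conjI allI impI)
  show "length (take (Suc (length w)) \<gamma>) = Suc (length w)" "take (Suc (length w)) \<gamma> ! 0 = x"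
    using assms unfolding path_reading_def by auto
  fix i assume i: "i < length w"
  then have "(\<gamma> ! i, (w @ u) ! i, \<gamma> ! Suc i) \<in> E"
    using assms unfolding path_reading_def by simp
  then show "(take (Suc (length w)) \<gamma> ! i, w ! i, take (Suc (length w)) \<gamma> ! Suc i) \<in> E"
    using i by (simp add: nth_append)
qed

text \<open>The easy half of Myhill--Nerode: by determinism the continuations of a word depend only
  on the vertex that it reaches.\<close>

lemma parameterizes_finite_continuations:
  assumes "parameterizes A V v E L"
  shows "finite ((\<lambda>w. {u. w @ u \<in> L}) ` L)"
proof (rule finite_subset)
  have dg: "labelled_digraph A V v E" and L: "L = {w. \<exists>\<gamma>. path_reading v E w \<gamma>}"
    using assms unfolding parameterizes_def by auto
  show "finite ((\<lambda>x. {u. \<exists>\<gamma>. path_reading x E u \<gamma>}) ` V)"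
    using dg unfolding labelled_digraph_def by simp
  show "(\<lambda>w. {u. w @ u \<in> L}) ` L \<subseteq> (\<lambda>x. {u. \<exists>\<gamma>. path_reading x E u \<gamma>}) ` V"
  proof (intro image_subsetI)
    fix w assume "w \<in> L"
    then obtain \<gamma> where \<gamma>: "path_reading v E w \<gamma>" using L by blast
    have "\<gamma> ! length w \<in> V"
    proof (cases "length w")
      case 0 then show ?thesis using \<gamma> dg unfolding path_reading_def labelled_digraph_def by simp
    next
      case (Suc i)
      then have "(\<gamma> ! i, w ! i, \<gamma> ! length w) \<in> E" using \<gamma> unfolding path_reading_def by simp
      then show ?thesis using dg unfolding labelled_digraph_def by blast
    qed
    moreover have "w @ u \<in> L \<longleftrightarrow> (\<exists>\<gamma>'. path_reading (\<gamma> ! length w) E u \<gamma>')" for u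
      unfolding path_reading_append[OF \<gamma>] L
      using path_reading_take path_reading_unique[OF dg _ \<gamma>] by blast
    ultimately show "{u. w @ u \<in> L} \<in> (\<lambda>x. {u. \<exists>\<gamma>. path_reading x E u \<gamma>}) ` V" by auto
  qed
qed

text \<open>The Myhill--Nerode construction; a vertex also remembers the last increment of \<open>\<phi>\<close>.\<close>
lemma ex_parameterization:
  assumes A: "finite A" "L \<subseteq> lists A" and pc: "prefix_closed L" and Nil: "[] \<in> L"
    and fin: "finite (futures L \<phi> ` L)"
  shows "\<exists>V v E d\<phi>. parameterizes A V v E L \<and>
    (\<forall>w\<in>L. \<forall>\<gamma>. path_reading v E w \<gamma> \<longrightarrow> \<phi> w = (\<Sum>i = 0..length w. d\<phi> (\<gamma> ! i)))"
proof -
  \<comment> \<open>\<open>d\<phi>\<close> lives on vertices while increments belong to edges, and a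
    future does not tell with which increment it was reached; hence the pair \<open>q\<close>. At
    the empty word the value \<open>\<phi> []\<close> starts the telescoping sum.\<close>
  define inc where "inc w = (if w = [] then \<phi> [] else \<phi> w - \<phi> (butlast w))" for w
  define q where "q w = (futures L \<phi> w, inc w)" for w
  have pre: "u \<in> L" if "u @ w \<in> L" for u w using pc that unfolding prefix_closed_def by blast
  have "finite (q ` L)"
  proof (rule finite_subset)
    \<comment> \<open>A last increment is read off the future of the prefix, through a one-letter
      continuation; finitely many futures and letters leave finitely many values.\<close>
    let ?I = "insert (\<phi> []) (\<Union>F\<in>futures L \<phi> ` L. \<Union>a\<in>A. {n. ([a], n) \<in> F})"
    have "finite {n. ([a], n) \<in> futures L \<phi> w}" for a w
      by (rule finite_subset[of _ "{\<phi> (w @ [a]) - \<phi> w}"]) (auto simp: in_futures_iff)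
    then have "finite (\<Union>a\<in>A. {n. ([a], n) \<in> F})" if "F \<in> futures L \<phi> ` L" for F
      using that A(1) by blast
    then have "finite ?I" by (intro finite.insertI finite_UN_I[OF fin])
    then show "finite (futures L \<phi> ` L \<times> ?I)" using fin by blast
    have "inc w \<in> ?I" if w: "w \<in> L" for w
    proof (cases w rule: rev_cases)
      case Nil then show ?thesis unfolding inc_def by simp
    next
      case (snoc u a)
      then have "([a], inc w) \<in> futures L \<phi> u" "u \<in> L" "a \<in> A"
        using w pre A(2) unfolding inc_def in_futures_iff by auto
      then show ?thesis by blast
    qed
    then show "q ` L \<subseteq> futures L \<phi> ` L \<times> ?I"
      unfolding q_def by (intro image_subsetI SigmaI imageI)
  qed
  then obtain e :: "_ \<Rightarrow> nat" where e: "inj_on e (q ` L)"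
    using finite_imp_inj_to_nat_seg[of "q ` L"] by blast
  define code where "code w = e (q w)" for w
  have code_eq: "q w = q w'" if "w \<in> L" "w' \<in> L" "code w = code w'" for w w'
    using e that unfolding code_def inj_on_def by blast
  \<comment> \<open>Transitions are well defined on codes: the future and the last increment of
    \<open>w @ [a]\<close> are both determined by the future of \<open>w\<close>.\<close>
  have step: "w' @ [a] \<in> L \<and> code (w' @ [a]) = code (w @ [a])"
    if w: "w' \<in> L" "code w = code w'" "w @ [a] \<in> L" for w w' a
  proof -
    have F: "futures L \<phi> w = futures L \<phi> w'" using code_eq[of w w'] w pre unfolding q_def by blast
    have *: "w' @ u \<in> L \<longleftrightarrow> w @ u \<in> L" "w @ u \<in> L \<Longrightarrow> \<phi> (w' @ u) - \<phi> w' = \<phi> (w @ u) - \<phi> w" for u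
      using F in_futures_iff by metis+
    have "(u, n) \<in> futures L \<phi> (w' @ [a]) \<longleftrightarrow> (u, n) \<in> futures L \<phi> (w @ [a])" for u n
      using *(1)[of "a # u"] *(2)[of "a # u"] *(2)[of "[a]"] w(3) unfolding in_futures_iff by auto
    then have "futures L \<phi> (w' @ [a]) = futures L \<phi> (w @ [a])" by auto
    moreover have "inc (w' @ [a]) = inc (w @ [a])" using *(2)[OF w(3)] unfolding inc_def by simp
    ultimately show ?thesis using *(1) w(3) unfolding code_def q_def by simp
  qed
  define E where "E = {(code w, a, code (w @ [a])) | w a. w @ [a] \<in> L}"
  define d\<phi> where "d\<phi> n = inc (SOME w. w \<in> L \<and> code w = n)" for n
  have d\<phi>: "d\<phi> (code w) = inc w" if w: "w \<in> L" for w
  proof -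
    define w' where "w' = (SOME w'. w' \<in> L \<and> code w' = code w)"
    have "w' \<in> L \<and> code w' = code w" unfolding w'_def by (rule someI[of _ w]) (use w in simp)
    then show ?thesis using code_eq[of w' w] w unfolding d\<phi>_def q_def w'_def by blast
  qed
  have dg: "labelled_digraph A (code ` L) (code []) E"
    unfolding labelled_digraph_def
  proof (intro conjI allI impI)
    show "finite (code ` L)" using \<open>finite (q ` L)\<close> unfolding code_def
      by (metis finite_imageI image_image)
    show "code [] \<in> code ` L" using Nil by blast
    show "E \<subseteq> code ` L \<times> A \<times> code ` L"
      unfolding E_def using pre A(2) by fastforce
    fix x a y y' assume "(x, a, y) \<in> E \<and> (x, a, y') \<in> E"
    then obtain w w' where "x = code w" "x = code w'" "w @ [a] \<in> L" "w' @ [a] \<in> L"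
        "y = code (w @ [a])" "y' = code (w' @ [a])"
      unfolding E_def by blast
    then show "y = y'" using step[of w' w a] pre by metis
  qed
  have path: "\<gamma> ! i = code (take i w) \<and> take i w \<in> L"
    if \<gamma>: "path_reading (code []) E w \<gamma>" and i: "i \<le> length w" for w \<gamma> i
    using i
  proof (induction i)
    case 0 then show ?case using \<gamma> Nil unfolding path_reading_def by simp
  next
    case (Suc i)
    then have IH: "\<gamma> ! i = code (take i w)" "take i w \<in> L" by auto
    have "(\<gamma> ! i, w ! i, \<gamma> ! Suc i) \<in> E" 
      using \<gamma> Suc.prems unfolding path_reading_def by (simp add: Suc_le_eq)
    then obtain u where u: "\<gamma> ! i = code u" "\<gamma> ! Suc i = code (u @ [w ! i])" "u @ [w ! i] \<in> L"
      unfolding E_def by blast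
    then have "take i w @ [w ! i] \<in> L \<and> code (take i w @ [w ! i]) = code (u @ [w ! i])"
      using step[of "take i w" u "w ! i"] IH by simp
    then show ?case using u(2) Suc.prems by (simp add: take_Suc_conv_app_nth)
  qed
  have "path_reading (code []) E w (map (\<lambda>i. code (take i w)) [0..<Suc (length w)])" if w: "w \<in> L" for w
    unfolding path_reading_def
  proof (intro conjI allI impI)
    fix i assume i: "i < length w"
    have "take (Suc i) w \<in> L" using pre[of "take (Suc i) w" "drop (Suc i) w"] w by simp
    then have "(code (take i w), w ! i, code (take (Suc i) w)) \<in> E"
      using i unfolding E_def by (auto simp: take_Suc_conv_app_nth)
    then show "(map (\<lambda>i. code (take i w)) [0..<Suc (length w)] ! i, w ! i,
        map (\<lambda>i. code (take i w)) [0..<Suc (length w)] ! Suc i) \<in> E"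
      using i by (simp del: upt_Suc)
  qed (simp_all del: upt_Suc)
  moreover have "w \<in> L" if "path_reading (code []) E w \<gamma>" for w \<gamma>
    using path[OF that, of "length w"] by simp
  ultimately have "L = {w. \<exists>\<gamma>. path_reading (code []) E w \<gamma>}" by blast
  then have "parameterizes A (code ` L) (code []) E L" using dg unfolding parameterizes_def by blast
  moreover have "\<phi> w = (\<Sum>i = 0..length w. d\<phi> (\<gamma> ! i))"
    if w: "w \<in> L" and \<gamma>: "path_reading (code []) E w \<gamma>" for w \<gamma>
  proof -
    have "\<phi> (take n w) = (\<Sum>i = 0..n. inc (take i w))" if "n \<le> length w" for n
      using that
    proof (induction n)
      case 0 then show ?case by (simp add: inc_def)
    next
      case (Suc n)
      have "take (Suc n) w \<noteq> []" using Suc.prems by auto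
      then have "inc (take (Suc n) w) = \<phi> (take (Suc n) w) - \<phi> (take n w)"
        using Suc.prems butlast_take[of "Suc n" w] unfolding inc_def by simp
      then show ?case using Suc by simp
    qed
    from this[of "length w"] have "\<phi> w = (\<Sum>i = 0..length w. inc (take i w))" by simp
    also have "\<dots> = (\<Sum>i = 0..length w. d\<phi> (\<gamma> ! i))"
      using path[OF \<gamma>] d\<phi> by (intro sum.cong) auto
    finally show ?thesis .
  qed
  ultimately show ?thesis by blast
qed

text \<open>Membership is separated from increments: \<open>L\<close> is already regular, so its
  finitely many sets of continuations are paired with \<open>c\<close>, and \<open>\<phi>\<close> is
  compared only where both continuations lie in \<open>L\<close>.\<close>

lemma weakly_combable_wrtI:
  assumes A: "finite A" and L: "combing G A L" and c: "finite (c ` L)"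
    and \<phi>: "\<And>w w' u. w \<in> L \<Longrightarrow> w' \<in> L \<Longrightarrow> c w = c w' \<Longrightarrow> w @ u \<in> L \<Longrightarrow> w' @ u \<in> L \<Longrightarrow>
      \<phi> (eval_word G (w' @ u)) - \<phi> (eval_word G w') = \<phi> (eval_word G (w @ u)) - \<phi> (eval_word G w)"
    and one: "\<one>\<^bsub>G\<^esub> \<in> carrier G"
  shows "weakly_combable_wrt G A L \<phi>"
proof -
  have sub: "L \<subseteq> lists A" and pc: "prefix_closed L" and bij: "bij_betw (eval_word G) L (carrier G)"
    using L unfolding combing_def by auto
  obtain V v E where "parameterizes A V v E L" using L unfolding combing_def by blast
  then have fin: "finite ((\<lambda>w. {u. w @ u \<in> L}) ` L)" by (rule parameterizes_finite_continuations)
  \<comment> \<open>Some word of \<open>L\<close> represents the identity, so \<open>L\<close> is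
    nonempty and prefix closure yields the empty word.\<close>
  have "L \<noteq> {}" using bij one unfolding bij_betw_def by blast
  then have Nil: "[] \<in> L" using pc unfolding prefix_closed_def by (metis append_Nil ex_in_conv)
  have "finite (futures L (\<lambda>w. \<phi> (eval_word G w)) ` L)"
  proof (rule finite_futuresI)
    show "finite ((\<lambda>w. (c w, {u. w @ u \<in> L})) ` L)"
      by (rule finite_subset[OF _ finite_cartesian_product[OF c fin]]) auto
  next
    fix w w' u
    assume w: "w \<in> L" "w' \<in> L" "(c w, {u. w @ u \<in> L}) = (c w', {u. w' @ u \<in> L})" "w @ u \<in> L"
    then have "w' @ u \<in> L" by blast
    then show "w' @ u \<in> L \<and> \<phi> (eval_word G (w' @ u)) - \<phi> (eval_word G w') =
        \<phi> (eval_word G (w @ u)) - \<phi> (eval_word G w)"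
      using \<phi>[of w w' u] w by blast
  qed
  then show ?thesis
    using ex_parameterization[OF A sub pc Nil, of "\<lambda>w. \<phi> (eval_word G w)"]
    unfolding weakly_combable_wrt_def by blast
qed

section \<open>Combability and the quasimorphism property\<close>

context group
begin

section \<open>Length profiles and increments\<close>

text \<open>Akin to the \<open>N\<close>-types behind Cannon's cone types, with the ball taken in
  \<open>A\<close> and the lengths in \<open>S\<close>. \<open>restrict\<close> makes all profiles
  agree outside the ball, so that equality means equality on the ball.\<close>

definition length_profile :: "'a set \<Rightarrow> nat \<Rightarrow> 'a set \<Rightarrow> 'a \<Rightarrow> 'a \<Rightarrow> int" where
  "length_profile A D S g =
     restrict (\<lambda>k. int (word_length G S (g \<otimes> k)) - int (word_length G S g))
       {k \<in> carrier G. word_length G A k \<le> D}"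

lemma finite_length_profiles:
  assumes A: "word_generating_set A" "finite A" and S: "word_generating_set S"
  shows "finite (length_profile A D S ` carrier G)"
proof (rule finite_subset)
  let ?B = "{k \<in> carrier G. word_length G A k \<le> D}"
  let ?I = "\<lambda>k. {- int (word_length G S (inv k))..int (word_length G S k)}"
  show "length_profile A D S ` carrier G \<subseteq> Pi\<^sub>E ?B ?I"
  proof (intro image_subsetI)
    fix g assume g: "g \<in> carrier G"
    have "int (word_length G S (g \<otimes> k)) - int (word_length G S g) \<in> ?I k" if k: "k \<in> carrier G" for k
    proof -
      have "g = (g \<otimes> k) \<otimes> inv k" using g k by (simp add: m_assoc)
      then have "word_length G S g \<le> word_length G S (g \<otimes> k) + word_length G S (inv k)"
        using word_length_mult[OF S, of "g \<otimes> k" "inv k"] g k by simp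
      then show ?thesis using word_length_mult[OF S g k] by simp
    qed
    then show "length_profile A D S g \<in> Pi\<^sub>E ?B ?I"
      unfolding length_profile_def by auto
  qed
  show "finite (Pi\<^sub>E ?B ?I)" using finite_word_ball[OF A] by (intro finite_PiE) auto
qed

lemma length_profileD:
  assumes "length_profile A D S g = length_profile A D S g'" "k \<in> carrier G" "word_length G A k \<le> D"
  shows "int (word_length G S (g' \<otimes> k)) - int (word_length G S g') =
    int (word_length G S (g \<otimes> k)) - int (word_length G S g)"
  using fun_cong[OF assms(1), of k] assms(2,3) unfolding length_profile_def by simp

text \<open>An \<open>S\<close>-geodesic to \<open>g \<otimes> h\<close> passes through some
  \<open>g \<otimes> k\<close> with \<open>k\<close> in the ball; its tail from \<open>k\<close> to
  \<open>h\<close>, translated to start at \<open>g' \<otimes> k\<close>, leads to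
  \<open>g' \<otimes> h\<close> at the same cost. Only \<open>g \<otimes> h\<close> is known to
  extend \<open>g\<close> geodesically, so the estimate is one-sided;
  \<open>word_length_future_eq\<close> exchanges \<open>g\<close> and \<open>g'\<close>.\<close>

lemma word_length_future_le:
  assumes hyp: "word_hyperbolic G"
    and A: "word_generating_set A" "finite A" and S: "word_generating_set S" "finite S"
  shows "\<exists>D. \<forall>g\<in>carrier G. \<forall>g'\<in>carrier G. \<forall>h\<in>carrier G.
    length_profile A D S g = length_profile A D S g' \<and>
    word_length G A (g \<otimes> h) = word_length G A g + word_length G A h \<longrightarrow>
    int (word_length G S (g' \<otimes> h)) - int (word_length G S g') \<le>
    int (word_length G S (g \<otimes> h)) - int (word_length G S g)"
proof -
  obtain D where D: "\<And>x p y. x \<in> carrier G \<Longrightarrow> p \<in> carrier G \<Longrightarrow> y \<in> carrier G \<Longrightarrow>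
    word_dist G A x p + word_dist G A p y = word_dist G A x y \<Longrightarrow>
    \<exists>q \<in> carrier G. word_dist G S x q + word_dist G S q y = word_dist G S x y \<and> word_dist G A p q \<le> D"
    using interval_near_interval[OF assms] by blast
  have "int (word_length G S (g' \<otimes> h)) - int (word_length G S g') \<le>
      int (word_length G S (g \<otimes> h)) - int (word_length G S g)"
    if c: "g \<in> carrier G" "g' \<in> carrier G" "h \<in> carrier G"
      and eq: "length_profile A D S g = length_profile A D S g'"
      and add: "word_length G A (g \<otimes> h) = word_length G A g + word_length G A h" for g g' h
  proof -
    obtain q where q: "q \<in> carrier G" "word_dist G A g q \<le> D"
        "word_dist G S \<one> q + word_dist G S q (g \<otimes> h) = word_dist G S \<one> (g \<otimes> h)"
      using D[of \<one> g "g \<otimes> h"] c add by (auto simp: word_dist_one word_dist_mult)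
    define k where "k = inv g \<otimes> q"
    have k: "k \<in> carrier G" "q = g \<otimes> k" "word_length G A k \<le> D"
      using q c unfolding k_def word_dist_def by auto
    have "word_length G S (g \<otimes> h) = word_length G S (g \<otimes> k) + word_dist G S k h"
      using q(3) c k by (simp add: word_dist_one word_dist_left_invariant)
    moreover have "word_length G S (g' \<otimes> h) \<le> word_length G S (g' \<otimes> k) + word_dist G S k h"
      using word_dist_triangle[OF S(1), of \<one> "g' \<otimes> k" "g' \<otimes> h"] c k
      by (simp add: word_dist_one word_dist_left_invariant)
    ultimately show ?thesis using length_profileD[OF eq k(1,3)] by linarith
  qed
  then show ?thesis by blast
qed

lemma combingD:
  assumes "combing G A L" and A: "word_generating_set A"
  shows "L \<subseteq> lists A"
    and "w \<in> L \<Longrightarrow> set w \<subseteq> carrier G"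
    and "w @ u \<in> L \<Longrightarrow> eval_word G (w @ u) = eval_word G w \<otimes> eval_word G u \<and>
      eval_word G u \<in> carrier G \<and> word_length G A (eval_word G w \<otimes> eval_word G u) =
      word_length G A (eval_word G w) + word_length G A (eval_word G u)"
proof -
  show L: "L \<subseteq> lists A" using assms unfolding combing_def by blast
  show "set w \<subseteq> carrier G" if "w \<in> L" for w using lists_carrier[OF A] L that by blast
  assume wu: "w @ u \<in> L"
  have sets: "set w \<subseteq> carrier G" "set u \<subseteq> carrier G" "w \<in> lists A" "u \<in> lists A"
    using subsetD[OF L wu] lists_carrier[OF A, of w] lists_carrier[OF A, of u] by auto
  then have e: "eval_word G (w @ u) = eval_word G w \<otimes> eval_word G u"
    by (simp add: eval_word_append)
  have "length w + length u = word_length G A (eval_word G w \<otimes> eval_word G u)"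
    using assms(1) wu e unfolding combing_def geodesic_word_def by fastforce
  moreover have "word_length G A (eval_word G w \<otimes> eval_word G u) \<le>
      word_length G A (eval_word G w) + word_length G A (eval_word G u)"
    using word_length_mult[OF A] sets by simp
  ultimately show "eval_word G (w @ u) = eval_word G w \<otimes> eval_word G u \<and>
      eval_word G u \<in> carrier G \<and> word_length G A (eval_word G w \<otimes> eval_word G u) =
      word_length G A (eval_word G w) + word_length G A (eval_word G u)"
    using e sets word_length_le[OF sets(3)] word_length_le[OF sets(4)] by simp
qed

lemma word_length_future_eq:
  assumes hyp: "word_hyperbolic G"
    and A: "word_generating_set A" "finite A" and S: "word_generating_set S" "finite S"
    and L: "combing G A L"
  shows "\<exists>D. \<forall>w u w'. w @ u \<in> L \<and> w' @ u \<in> L \<and>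
    length_profile A D S (eval_word G w) = length_profile A D S (eval_word G w') \<longrightarrow>
    int (word_length G S (eval_word G (w' @ u))) - int (word_length G S (eval_word G w')) =
    int (word_length G S (eval_word G (w @ u))) - int (word_length G S (eval_word G w))"
proof -
  obtain D where D: "\<And>g g' h. g \<in> carrier G \<Longrightarrow> g' \<in> carrier G \<Longrightarrow> h \<in> carrier G \<Longrightarrow>
    length_profile A D S g = length_profile A D S g' \<Longrightarrow>
    word_length G A (g \<otimes> h) = word_length G A g + word_length G A h \<Longrightarrow>
    int (word_length G S (g' \<otimes> h)) - int (word_length G S g') \<le>
    int (word_length G S (g \<otimes> h)) - int (word_length G S g)"
    using word_length_future_le[OF hyp A S] by blast
  have "int (word_length G S (eval_word G (w' @ u))) - int (word_length G S (eval_word G w')) =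
    int (word_length G S (eval_word G (w @ u))) - int (word_length G S (eval_word G w))"
    if wu: "w @ u \<in> L" "w' @ u \<in> L"
      and eq: "length_profile A D S (eval_word G w) = length_profile A D S (eval_word G w')" for w u w'
  proof -
    have c: "eval_word G w \<in> carrier G" "eval_word G w' \<in> carrier G"
      using combingD(2)[OF L A(1) wu(1)] combingD(2)[OF L A(1) wu(2)] by auto
    note w = combingD(3)[OF L A(1) wu(1)] and w' = combingD(3)[OF L A(1) wu(2)]
    show ?thesis
      using D[of "eval_word G w" "eval_word G w'" "eval_word G u"]
        D[of "eval_word G w'" "eval_word G w" "eval_word G u"] c w w' eq by simp
  qed
  then show ?thesis by blast
qed

lemma word_length_lipschitz:
  assumes A: "symmetric_generating_set G A" and S: "word_generating_set S"
  shows "\<exists>K. \<forall>a\<in>carrier G. \<forall>s\<in>A.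
    \<bar>int (word_length G S (a \<otimes> s)) - int (word_length G S a)\<bar> \<le> K \<and>
    \<bar>int (word_length G S (s \<otimes> a)) - int (word_length G S a)\<bar> \<le> K"
proof -
  note A' = symmetric_generating_setD[OF A]
  obtain K where K: "\<And>g. g \<in> carrier G \<Longrightarrow> word_length G S g \<le> K * word_length G A g"
    using word_length_compare[OF A'(2,1) S] by blast
  have "\<bar>int (word_length G S (a \<otimes> s)) - int (word_length G S a)\<bar> \<le> int K \<and>
      \<bar>int (word_length G S (s \<otimes> a)) - int (word_length G S a)\<bar> \<le> int K"
    if a: "a \<in> carrier G" and s: "s \<in> A" for a s
  proof -
    have sc: "s \<in> carrier G" using s A'(2) unfolding word_generating_set_def by blast
    have small: "word_length G S t \<le> K" if t: "t \<in> A" for t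
    proof -
      have tc: "t \<in> carrier G" using t A'(2) unfolding word_generating_set_def by blast
      have "word_length G A t \<le> 1" using word_length_le[of "[t]" A] t tc by simp
      then show ?thesis using K[OF tc] mult_le_mono2[of "word_length G A t" 1 K] by linarith
    qed
    have "inv s \<in> A" using s A'(3) unfolding SET_INV_def by blast
    then have "word_length G S s \<le> K" "word_length G S (inv s) \<le> K" using small s by auto
    moreover have "a = (a \<otimes> s) \<otimes> inv s" "a = inv s \<otimes> (s \<otimes> a)" using a sc by (simp_all add: m_assoc)
    then have "word_length G S a \<le> word_length G S (a \<otimes> s) + word_length G S (inv s)"
        "word_length G S a \<le> word_length G S (inv s) + word_length G S (s \<otimes> a)"
      using word_length_mult[OF S, of "a \<otimes> s" "inv s"] word_length_mult[OF S, of "inv s" "s \<otimes> a"] a sc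
      by auto
    ultimately show ?thesis using word_length_mult[OF S a sc] word_length_mult[OF S sc a] by linarith
  qed
  then show ?thesis by blast
qed

text \<open>Stated for integer combinations, so that one proof covers both lengths and their
  difference. Pairing the profiles for \<open>S\<close> and \<open>T\<close> takes the place of a
  product of digraphs.\<close>

lemma bicombable_wrt_word_lengths:
  assumes hyp: "word_hyperbolic G" and A: "symmetric_generating_set G A" and L: "combing G A L"
    and S: "word_generating_set S" "finite S" and T: "word_generating_set T" "finite T"
  shows "bicombable_wrt G A L (\<lambda>g. a * int (word_length G S g) + b * int (word_length G T g))"
    (is "bicombable_wrt G A L ?\<phi>")
  unfolding bicombable_wrt_def
proof
  note A' = symmetric_generating_setD(2,1)[OF A]
  obtain D where D: "\<And>w u w'. w @ u \<in> L \<Longrightarrow> w' @ u \<in> L \<Longrightarrow>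
    length_profile A D S (eval_word G w) = length_profile A D S (eval_word G w') \<Longrightarrow>
    int (word_length G S (eval_word G (w' @ u))) - int (word_length G S (eval_word G w')) =
    int (word_length G S (eval_word G (w @ u))) - int (word_length G S (eval_word G w))"
    using word_length_future_eq[OF hyp A' S L] by blast
  obtain D' where D': "\<And>w u w'. w @ u \<in> L \<Longrightarrow> w' @ u \<in> L \<Longrightarrow>
    length_profile A D' T (eval_word G w) = length_profile A D' T (eval_word G w') \<Longrightarrow>
    int (word_length G T (eval_word G (w' @ u))) - int (word_length G T (eval_word G w')) =
    int (word_length G T (eval_word G (w @ u))) - int (word_length G T (eval_word G w))"
    using word_length_future_eq[OF hyp A' T L] by blast
  let ?c = "\<lambda>w. (length_profile A D S (eval_word G w), length_profile A D' T (eval_word G w))"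
  show "weakly_combable_wrt G A L ?\<phi>"
  proof (rule weakly_combable_wrtI[OF A'(2) L, where c = ?c])
    have "eval_word G w \<in> carrier G" if "w \<in> L" for w using combingD(2)[OF L A'(1) that] by simp
    then have "?c ` L \<subseteq> length_profile A D S ` carrier G \<times> length_profile A D' T ` carrier G"
      by blast
    then show "finite (?c ` L)"
      using finite_length_profiles[OF A' S(1)] finite_length_profiles[OF A' T(1)]
      by (rule finite_subset[OF _ finite_cartesian_product])
  next
    fix w w' u assume "?c w = ?c w'" "w @ u \<in> L" "w' @ u \<in> L"
    then have
      "int (word_length G S (eval_word G (w' @ u))) =
        int (word_length G S (eval_word G (w @ u))) - int (word_length G S (eval_word G w))
        + int (word_length G S (eval_word G w'))"
      "int (word_length G T (eval_word G (w' @ u))) =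
        int (word_length G T (eval_word G (w @ u))) - int (word_length G T (eval_word G w))
        + int (word_length G T (eval_word G w'))"
      using D[of w u w'] D'[of w u w'] by simp_all
    then show "?\<phi> (eval_word G (w' @ u)) - ?\<phi> (eval_word G w') =
        ?\<phi> (eval_word G (w @ u)) - ?\<phi> (eval_word G w)"
      by (simp only:) (simp add: algebra_simps)
  qed simp
  obtain K where K: "\<And>x s. x \<in> carrier G \<Longrightarrow> s \<in> A \<Longrightarrow>
    \<bar>int (word_length G S (x \<otimes> s)) - int (word_length G S x)\<bar> \<le> K \<and>
    \<bar>int (word_length G S (s \<otimes> x)) - int (word_length G S x)\<bar> \<le> K"
    using word_length_lipschitz[OF A S(1)] by blast
  obtain K' where K': "\<And>x s. x \<in> carrier G \<Longrightarrow> s \<in> A \<Longrightarrow>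
    \<bar>int (word_length G T (x \<otimes> s)) - int (word_length G T x)\<bar> \<le> K' \<and>
    \<bar>int (word_length G T (s \<otimes> x)) - int (word_length G T x)\<bar> \<le> K'"
    using word_length_lipschitz[OF A T(1)] by blast
  have comb: "\<bar>(a * m + b * n) - (a * m' + b * n')\<bar> \<le> \<bar>a\<bar> * K + \<bar>b\<bar> * K'"
    if "\<bar>m - m'\<bar> \<le> K" "\<bar>n - n'\<bar> \<le> K'" for m n m' n' :: int
  proof -
    have "\<bar>a * (m - m') + b * (n - n')\<bar> \<le> \<bar>a\<bar> * \<bar>m - m'\<bar> + \<bar>b\<bar> * \<bar>n - n'\<bar>"
      by (metis abs_triangle_ineq abs_mult)
    moreover have "\<bar>a\<bar> * \<bar>m - m'\<bar> \<le> \<bar>a\<bar> * K" "\<bar>b\<bar> * \<bar>n - n'\<bar> \<le> \<bar>b\<bar> * K'"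
      using that by (simp_all add: mult_left_mono)
    ultimately show ?thesis by (simp add: algebra_simps)
  qed
  show "\<exists>C. \<forall>x\<in>carrier G. \<forall>s\<in>A. \<bar>?\<phi> (x \<otimes> s) - ?\<phi> x\<bar> \<le> C \<and> \<bar>?\<phi> (s \<otimes> x) - ?\<phi> x\<bar> \<le> C"
    using K K' comb by (intro exI[of _ "\<bar>a\<bar> * K + \<bar>b\<bar> * K'"]) blast
qed

section \<open>The quasimorphism estimate\<close>

text \<open>Let \<open>q\<close> be a point of the \<open>S\<close>-interval near \<open>p\<close>.
  Passing through \<open>c\<close> instead costs a detour from \<open>q\<close> to \<open>c\<close>
  and one back, each bounded through the undirected \<open>B\<close>-distance; hence the constant
  \<open>2 * (K * (r + D))\<close>.\<close>

lemma word_dist_nearly_additive: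
  assumes hyp: "word_hyperbolic G" and B: "symmetric_generating_set G B"
    and S: "word_generating_set S" "finite S"
  shows "\<exists>D. \<forall>x y c p. x \<in> carrier G \<and> y \<in> carrier G \<and> c \<in> carrier G \<and> p \<in> carrier G \<and>
    word_dist G B x p + word_dist G B p y = word_dist G B x y \<and> word_dist G B c p \<le> r \<longrightarrow>
    word_dist G S x c + word_dist G S c y \<le> word_dist G S x y + D"
proof -
  note B' = symmetric_generating_setD(2,1)[OF B]
  obtain D where D: "\<And>x p y. x \<in> carrier G \<Longrightarrow> p \<in> carrier G \<Longrightarrow> y \<in> carrier G \<Longrightarrow>
    word_dist G B x p + word_dist G B p y = word_dist G B x y \<Longrightarrow>
    \<exists>q \<in> carrier G. word_dist G S x q + word_dist G S q y = word_dist G S x y \<and> word_dist G B p q \<le> D"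
    using interval_near_interval[OF hyp B' S] by blast
  obtain K where K: "\<And>g. g \<in> carrier G \<Longrightarrow> word_length G S g \<le> K * word_length G B g"
    using word_length_compare[OF B' S(1)] by blast
  have "word_dist G S x c + word_dist G S c y \<le> word_dist G S x y + 2 * (K * (r + D))"
    if c: "x \<in> carrier G" "y \<in> carrier G" "c \<in> carrier G" "p \<in> carrier G"
      and p: "word_dist G B x p + word_dist G B p y = word_dist G B x y" "word_dist G B c p \<le> r"
    for x y c p
  proof -
    obtain q where q: "q \<in> carrier G" "word_dist G B p q \<le> D"
      "word_dist G S x q + word_dist G S q y = word_dist G S x y"
      using D[OF c(1,4,2) p(1)] by blast
    have cq: "word_dist G B c q \<le> r + D"
      using word_dist_triangle[OF B'(1) c(3,4) q(1)] p q by linarith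
    then have qc: "word_dist G B q c \<le> r + D" using word_dist_sym[OF B c(3) q(1)] by simp
    have "word_dist G S c q \<le> K * (r + D)" "word_dist G S q c \<le> K * (r + D)"
      using K[of "inv c \<otimes> q"] K[of "inv q \<otimes> c"] c q cq qc unfolding word_dist_def
      by (meson inv_closed le_trans m_closed mult_le_mono2)+
    then show ?thesis
      using word_dist_triangle[OF S(1) c(1) q(1) c(3)] word_dist_triangle[OF S(1) c(3) q(1) c(2)] q(3)
      by linarith
  qed
  then show ?thesis by blast
qed

lemma quasimorphism_word_length_diff:
  assumes hyp: "word_hyperbolic G" and S: "word_generating_set S" "finite S"
  shows "\<exists>D. \<forall>a\<in>carrier G. \<forall>b\<in>carrier G.
    \<bar>(int (word_length G S a) - int (word_length G S (inv a))) +
     (int (word_length G S b) - int (word_length G S (inv b))) -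
     (int (word_length G S (a \<otimes> b)) - int (word_length G S (inv (a \<otimes> b))))\<bar> \<le> D"
proof -
  obtain B \<delta> where B: "symmetric_generating_set G B" "slim_triangles G B \<delta>"
    using hyp unfolding word_hyperbolic_def by blast
  interpret slim_metric "carrier G" "word_dist G B" \<delta> using slim_metric_word_dist[OF B] .
  obtain D where D: "\<And>x y c p. c \<in> carrier G \<Longrightarrow> btw x p y \<Longrightarrow> word_dist G B c p \<le> \<delta> + 1 \<Longrightarrow>
    word_dist G S x c + word_dist G S c y \<le> word_dist G S x y + D"
    using word_dist_nearly_additive[OF hyp B(1) S, of "\<delta> + 1"] unfolding btw_def by blast
  have "\<bar>(int (word_length G S a) - int (word_length G S (inv a))) +
     (int (word_length G S b) - int (word_length G S (inv b))) -
     (int (word_length G S (a \<otimes> b)) - int (word_length G S (inv (a \<otimes> b))))\<bar> \<le> 3 * int D"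
    if ab: "a \<in> carrier G" "b \<in> carrier G" for a b
  proof -
    define z where "z = a \<otimes> b"
    have z: "z \<in> carrier G" unfolding z_def using ab by simp
    obtain c p q where c: "btw \<one> c z" "btw \<one> p a" "btw a q z"
        "word_dist G B c p \<le> \<delta>" "word_dist G B c q \<le> \<delta> + 1"
      using triangle_center[of \<one> z a] ab z by auto
    have cc: "c \<in> carrier G" using c(1) unfolding btw_def by blast
    \<comment> \<open>For either direction of a side, the excess of the route through
      \<open>c\<close> lies between 0 and \<open>D\<close>. The difference of the two directions is
      thus off by at most \<open>D\<close>, and the three sides give \<open>3 * D\<close>.\<close>
    have near: "word_dist G S x y \<le> word_dist G S x c + word_dist G S c y \<and>
        word_dist G S x c + word_dist G S c y \<le> word_dist G S x y + D \<and>
        word_dist G S y x \<le> word_dist G S y c + word_dist G S c x \<and>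
        word_dist G S y c + word_dist G S c x \<le> word_dist G S y x + D"
      if "btw x p y" "word_dist G B c p \<le> \<delta> + 1" for x p y
      using D[OF cc that] D[OF cc btw_sym[OF that(1)] that(2)] that(1) cc
        word_dist_triangle[OF S(1), of x c y] word_dist_triangle[OF S(1), of y c x]
      unfolding btw_def by blast
    \<comment> \<open>\<open>c\<close> lies on the side from the identity to \<open>z\<close> and
      serves as its own nearby point there.\<close>
    have "word_dist G B c c \<le> \<delta> + 1" using word_dist_refl[OF cc] by simp
    note n = near[OF c(1) this] near[OF c(2) le_trans[OF c(4) le_add1]] near[OF c(3,5)]
    \<comment> \<open>All six lengths are directed distances between corners; taking inverses
      reverses the direction.\<close>
    have "word_length G S a = word_dist G S \<one> a" "word_length G S (inv a) = word_dist G S a \<one>"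
      "word_length G S z = word_dist G S \<one> z" "word_length G S (inv z) = word_dist G S z \<one>"
      "word_length G S b = word_dist G S a z" "word_length G S (inv b) = word_dist G S z a"
      using ab z by (simp_all add: word_dist_def z_def inv_mult_group m_assoc)
    then show ?thesis using n unfolding z_def[symmetric] by linarith
  qed
  then show ?thesis by blast
qed

end

section \<open>Shortlex combings\<close>

lemma lex_append_iff:
  assumes "length v = length w"
  shows "(v @ v', w @ w') \<in> lex R \<longleftrightarrow>
    (v, w) \<in> lex R \<and> length v' = length w' \<or> v = w \<and> (v', w') \<in> lex R"
  using assms
proof (induction v w rule: list_induct2)
  case (Cons a v b w)
  moreover have "(v', w') \<in> lex R \<Longrightarrow> length v' = length w'" by (simp add: lex_conv)
  ultimately show ?case by auto
qed simp

lemma lex_measure_total: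
  assumes "inj_on r A" "length v = length w" "v \<in> lists A" "w \<in> lists A"
  shows "v = w \<or> (v, w) \<in> lex (measure r) \<or> (w, v) \<in> lex (measure r)"
  using assms(2,3,4)
proof (induction v w rule: list_induct2)
  case (Cons a v b w)
  then show ?case using assms(1) unfolding inj_on_def by (cases "r a" "r b" rule: linorder_cases) auto
qed simp

context group
begin

text \<open>\<open>r\<close> numbers the letters. Geodesic words with the same value have the same
  length, so \<open>lex\<close>, which relates only words of equal length, realizes the shortlex
  order.\<close>

definition shortlex_language :: "'a set \<Rightarrow> ('a \<Rightarrow> nat) \<Rightarrow> 'a list set" where
  "shortlex_language A r = {w. geodesic_word G A w \<and>
     (\<forall>v \<in> lists A. length v = length w \<and> eval_word G v = eval_word G w \<longrightarrow> (v, w) \<notin> lex (measure r))}"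

text \<open>A shorter or lexicographically smaller substitute for a prefix would improve the whole
  word.\<close>

lemma shortlex_prefix_closed:
  assumes A: "word_generating_set A"
  shows "prefix_closed (shortlex_language A r)"
  unfolding prefix_closed_def
proof (intro allI impI)
  fix u w assume uw: "u @ w \<in> shortlex_language A r"
  have l: "u \<in> lists A" "w \<in> lists A"
    using uw unfolding shortlex_language_def geodesic_word_def by auto
  then have sets: "set u \<subseteq> carrier G" "set w \<subseteq> carrier G" using lists_carrier[OF A] by auto
  have "length u + length w = word_length G A (eval_word G u \<otimes> eval_word G w)"
    using uw sets unfolding shortlex_language_def geodesic_word_def by (simp add: eval_word_append)
  also have "\<dots> \<le> word_length G A (eval_word G u) + word_length G A (eval_word G w)"
    using word_length_mult[OF A] sets by simp
  finally have "length u = word_length G A (eval_word G u)"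
    using word_length_le[OF l(1)] word_length_le[OF l(2)] by linarith
  moreover have "(v, u) \<notin> lex (measure r)"
    if v: "v \<in> lists A" "length v = length u" "eval_word G v = eval_word G u" for v
  proof
    assume "(v, u) \<in> lex (measure r)"
    then have "(v @ w, u @ w) \<in> lex (measure r)" using v lex_append_iff[of v u w w] by simp
    moreover have "eval_word G (v @ w) = eval_word G (u @ w)"
      using v sets lists_carrier[OF A v(1)] by (simp add: eval_word_append)
    ultimately show False using uw v l unfolding shortlex_language_def by auto
  qed
  ultimately show "u \<in> shortlex_language A r"
    using l unfolding shortlex_language_def geodesic_word_def by blast
qed

text \<open>Totality of \<open>lex\<close> at fixed length gives uniqueness, its well-foundedness
  existence.\<close>

lemma shortlex_bij:
  assumes A: "word_generating_set A" and r: "inj_on r A"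
  shows "bij_betw (eval_word G) (shortlex_language A r) (carrier G)"
  unfolding bij_betw_def
proof
  show "inj_on (eval_word G) (shortlex_language A r)"
  proof (rule inj_onI)
    fix v w assume vw: "v \<in> shortlex_language A r" "w \<in> shortlex_language A r"
      and e: "eval_word G v = eval_word G w"
    then have l: "v \<in> lists A" "w \<in> lists A" "length v = length w"
      unfolding shortlex_language_def geodesic_word_def by auto
    then have "(v, w) \<notin> lex (measure r)" "(w, v) \<notin> lex (measure r)"
      using vw e unfolding shortlex_language_def by auto
    then show "v = w" using lex_measure_total[OF r l(3,1,2)] by blast
  qed
  show "eval_word G ` shortlex_language A r = carrier G"
  proof
    show "eval_word G ` shortlex_language A r \<subseteq> carrier G"
      using lists_carrier[OF A] eval_word_closed
      unfolding shortlex_language_def geodesic_word_def by blast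
    show "carrier G \<subseteq> eval_word G ` shortlex_language A r"
    proof
      fix g assume g: "g \<in> carrier G"
      define Q where "Q = {w \<in> lists A. length w = word_length G A g \<and> eval_word G w = g}"
      have "Q \<noteq> {}" using word_length_witness[OF A g] unfolding Q_def by auto
      moreover have "wf (lex (measure r))" by (intro wf_lex wf_measure)
      ultimately obtain w where w: "w \<in> Q" "\<And>v. (v, w) \<in> lex (measure r) \<Longrightarrow> v \<notin> Q"
        using wfE_min' by metis
      have "w \<in> shortlex_language A r"
        using w unfolding shortlex_language_def geodesic_word_def Q_def by auto
      then show "g \<in> eval_word G ` shortlex_language A r" using w(1) unfolding Q_def by blast
    qed
  qed
qed

section \<open>Cone types and regularity of the shortlex language\<close>

text \<open>Cannon's argument, one letter at a time. If the last letter failed to increase the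
  length, a geodesic to \<open>g' \<otimes> (h \<otimes> a)\<close> would pass near
  \<open>g'\<close> at some \<open>g' \<otimes> k\<close>, and equal profiles would carry the
  shortcut over to \<open>g\<close>. The estimate of \<open>word_length_future_le\<close> gives only
  the trivial upper bound here.\<close>

lemma cone_type_determined:
  assumes A: "symmetric_generating_set G A" and sl: "slim_triangles G A \<delta>"
    and c: "g \<in> carrier G" "g' \<in> carrier G"
    and eq: "length_profile A (\<delta> + 1) A g = length_profile A (\<delta> + 1) A g'"
    and "u \<in> lists A" "word_length G A (g \<otimes> eval_word G u) = word_length G A g + length u"
  shows "word_length G A (g' \<otimes> eval_word G u) = word_length G A g' + length u"
  using assms(6,7)
proof (induction u rule: rev_induct)
  case Nil
  then show ?case using c by simp
next
  case (snoc a u)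
  interpret slim_metric "carrier G" "word_dist G A" \<delta> using slim_metric_word_dist[OF A sl] .
  note gen = symmetric_generating_setD(2)[OF A]
  have l: "u \<in> lists A" "a \<in> A" using snoc by auto
  have ac: "a \<in> carrier G" using l gen unfolding word_generating_set_def by blast
  define h where "h = eval_word G u"
  have hc: "h \<in> carrier G" unfolding h_def using lists_carrier[OF gen l(1)] by simp
  have e: "eval_word G (u @ [a]) = h \<otimes> a"
    unfolding h_def using lists_carrier[OF gen l(1)] ac by (simp add: eval_word_append)
  have a1: "word_length G A a \<le> 1" using word_length_le[of "[a]" A] l ac by simp
  have h1: "word_length G A h \<le> length u" unfolding h_def using word_length_le[OF l(1)] .
  have full: "word_length G A (g \<otimes> (h \<otimes> a)) = word_length G A g + (length u + 1)"
    using snoc.prems e by simp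
  have "word_length G A (g \<otimes> (h \<otimes> a)) \<le> word_length G A (g \<otimes> h) + word_length G A a"
    using word_length_mult[OF gen, of "g \<otimes> h" a] c hc ac by (simp add: m_assoc)
  then have "word_length G A (g \<otimes> h) = word_length G A g + length u"
    using word_length_mult[OF gen c(1) hc] a1 h1 full by linarith
  then have IH: "word_length G A (g' \<otimes> h) = word_length G A g' + length u"
    using snoc.IH[OF l(1)] unfolding h_def by blast
  have up: "word_length G A (g' \<otimes> (h \<otimes> a)) \<le> word_length G A g' + (length u + 1)"
    using word_length_mult[OF gen c(2), of "h \<otimes> a"] word_length_mult[OF gen hc ac] hc ac a1 h1 by simp
  have "word_length G A g' + length u < word_length G A (g' \<otimes> (h \<otimes> a))"
  proof (rule ccontr)
    assume neg: "\<not> ?thesis"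
    have "btw \<one> g' (g' \<otimes> h)"
      using c hc IH h1 word_length_mult[OF gen c(2) hc]
      by (simp add: btw_def word_dist_one word_dist_mult)
    then obtain q where q: "btw \<one> q (g' \<otimes> (h \<otimes> a)) \<or> btw (g' \<otimes> (h \<otimes> a)) q (g' \<otimes> h)"
        "word_dist G A g' q \<le> \<delta>"
      using btw_slim[of \<one> g' "g' \<otimes> h" "g' \<otimes> (h \<otimes> a)"] c hc ac by auto
    \<comment> \<open>A point \<open>q\<close> on the third side, which has length at most 1, is
      replaced by the endpoint of that side; this is the \<open>+ 1\<close> in the radius of the
      profile.\<close>
    have "\<exists>q. btw \<one> q (g' \<otimes> (h \<otimes> a)) \<and> word_dist G A g' q \<le> \<delta> + 1"
      using q(1)
    proof
      assume "btw \<one> q (g' \<otimes> (h \<otimes> a))"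
      then show ?thesis using q(2) by auto
    next
      assume b: "btw (g' \<otimes> (h \<otimes> a)) q (g' \<otimes> h)"
      then have qc: "q \<in> carrier G" unfolding btw_def by blast
      have "word_dist G A (g' \<otimes> h) (g' \<otimes> (h \<otimes> a)) = word_length G A a"
        using word_dist_mult[of "g' \<otimes> h" a A] c hc ac by (simp add: m_assoc)
      then have "word_dist G A q (g' \<otimes> (h \<otimes> a)) \<le> 1"
        using b a1 dist_sym[of "g' \<otimes> h" "g' \<otimes> (h \<otimes> a)"] dist_sym[of q "g' \<otimes> (h \<otimes> a)"]
        unfolding btw_def by linarith
      then have "word_dist G A g' (g' \<otimes> (h \<otimes> a)) \<le> \<delta> + 1"
        using dist_tri[of g' q "g' \<otimes> (h \<otimes> a)"] q(2) c qc hc ac by simp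
      moreover have "btw \<one> (g' \<otimes> (h \<otimes> a)) (g' \<otimes> (h \<otimes> a))"
        using c hc ac word_dist_refl unfolding btw_def by simp
      ultimately show ?thesis by blast
    qed
    then obtain q' where q': "btw \<one> q' (g' \<otimes> (h \<otimes> a))" "word_dist G A g' q' \<le> \<delta> + 1" by blast
    define k where "k = inv g' \<otimes> q'"
    have k: "k \<in> carrier G" "q' = g' \<otimes> k" "word_length G A k \<le> \<delta> + 1"
      using q' c unfolding k_def word_dist_def btw_def by auto
    have "word_length G A (g' \<otimes> k) + word_dist G A k (h \<otimes> a) = word_length G A (g' \<otimes> (h \<otimes> a))"
      using q'(1) c k hc ac unfolding btw_def by (simp add: word_dist_one word_dist_left_invariant)
    moreover have "word_length G A (g \<otimes> (h \<otimes> a)) \<le> word_length G A (g \<otimes> k) + word_dist G A k (h \<otimes> a)"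
      using word_dist_triangle[OF gen, of \<one> "g \<otimes> k" "g \<otimes> (h \<otimes> a)"] c k hc ac
      by (simp add: word_dist_one word_dist_left_invariant)
    ultimately show False using length_profileD[OF eq k(1,3)] full neg by linarith
  qed
  then show ?case using up e by simp
qed

text \<open>The rivals of \<open>w\<close>. For \<open>D\<close> large enough, two geodesics with
  the same ends are this close at equal times, so a smaller word ending farther away cannot lead to
  a better geodesic for a continuation of \<open>w\<close>.\<close>

definition smaller_neighbours :: "'a set \<Rightarrow> ('a \<Rightarrow> nat) \<Rightarrow> nat \<Rightarrow> 'a list \<Rightarrow> 'a set" where
  "smaller_neighbours A r D w =
     {k \<in> carrier G. word_length G A k \<le> D \<and> (\<exists>v \<in> lists A. length v = length w \<and>
        eval_word G v = eval_word G w \<otimes> k \<and> (v, w) \<in> lex (measure r))}"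

text \<open>A rival \<open>v\<close> of \<open>w' @ u\<close> is split at the length of
  \<open>w'\<close>. Either its first part is \<open>w'\<close>, and its second part beats
  \<open>u\<close> after \<open>w\<close> as well; or its first part ends at a smaller neighbour of
  \<open>w'\<close>, and the matching neighbour of \<open>w\<close> followed by the second part of
  \<open>v\<close> beats \<open>w @ u\<close>.\<close>

lemma shortlex_future:
  assumes hyp: "word_hyperbolic G" and A: "symmetric_generating_set G A"
    and sl: "slim_triangles G A \<delta>"
  shows "\<exists>D. \<forall>w w' u. w \<in> shortlex_language A r \<and> w' \<in> shortlex_language A r \<and>
    length_profile A (\<delta> + 1) A (eval_word G w) = length_profile A (\<delta> + 1) A (eval_word G w') \<and>
    smaller_neighbours A r D w = smaller_neighbours A r D w' \<and> w @ u \<in> shortlex_language A r \<longrightarrow>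
    w' @ u \<in> shortlex_language A r"
proof -
  note gen = symmetric_generating_setD(2,1)[OF A]
  obtain D where D: "\<And>x p y P n. p \<in> carrier G \<Longrightarrow> cayley_geodesic G A P n x y \<Longrightarrow>
    word_dist G A x p + word_dist G A p y = word_dist G A x y \<Longrightarrow>
    \<exists>j\<le>n. word_dist G A p (P j) \<le> D"
    using interval_near_geodesic[OF hyp gen gen] by blast
  have "w' @ u \<in> shortlex_language A r"
    if w: "w \<in> shortlex_language A r" and w': "w' \<in> shortlex_language A r"
      and eq: "length_profile A (\<delta> + 1) A (eval_word G w) = length_profile A (\<delta> + 1) A (eval_word G w')"
      and nb: "smaller_neighbours A r (2 * D) w = smaller_neighbours A r (2 * D) w'"
      and wu: "w @ u \<in> shortlex_language A r" for w w' u
  proof -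
    define g g' h where "g = eval_word G w" and "g' = eval_word G w'" and "h = eval_word G u"
    have l: "w \<in> lists A" "w' \<in> lists A" "u \<in> lists A"
      using w w' wu unfolding shortlex_language_def geodesic_word_def by auto
    note sets = lists_carrier[OF gen(1) l(1)] lists_carrier[OF gen(1) l(2)] lists_carrier[OF gen(1) l(3)]
    have c: "g \<in> carrier G" "g' \<in> carrier G" "h \<in> carrier G"
      unfolding g_def g'_def h_def using sets by auto
    have e: "eval_word G (w @ u) = g \<otimes> h" "eval_word G (w' @ u) = g' \<otimes> h"
      unfolding g_def g'_def h_def using sets by (simp_all add: eval_word_append)
    have len: "length w = word_length G A g" "length w' = word_length G A g'"
        "length w + length u = word_length G A (g \<otimes> h)"
      using w w' wu e unfolding shortlex_language_def geodesic_word_def g_def g'_def by auto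
    then have len': "word_length G A (g' \<otimes> h) = word_length G A g' + length u"
      using cone_type_determined[OF A sl _ _ eq l(3)] c unfolding g_def g'_def h_def by simp
    have min: "(v, w @ u) \<notin> lex (measure r)"
      if "v \<in> lists A" "length v = length w + length u" "eval_word G v = g \<otimes> h" for v
      using wu that e unfolding shortlex_language_def by simp
    have "(v, w' @ u) \<notin> lex (measure r)"
      if v: "v \<in> lists A" "length v = length (w' @ u)" "eval_word G v = eval_word G (w' @ u)" for v
    proof
      assume lt: "(v, w' @ u) \<in> lex (measure r)"
      define v1 v2 where "v1 = take (length w') v" and "v2 = drop (length w') v"
      have v12: "v = v1 @ v2" "length v1 = length w'" "length v2 = length u"
        using v(2) unfolding v1_def v2_def by auto
      have vl: "v1 \<in> lists A" "v2 \<in> lists A" using v(1) v12(1) by auto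
      note vsets = lists_carrier[OF gen(1) vl(1)] lists_carrier[OF gen(1) vl(2)]
      define g1 h2 where "g1 = eval_word G v1" and "h2 = eval_word G v2"
      have vc: "g1 \<in> carrier G" "h2 \<in> carrier G" unfolding g1_def h2_def using vsets by auto
      have ev: "g1 \<otimes> h2 = g' \<otimes> h"
        using v(3) e(2) vsets unfolding g1_def h2_def v12(1) by (simp add: eval_word_append)
      have "(v1, w') \<in> lex (measure r) \<or> v1 = w' \<and> (v2, u) \<in> lex (measure r)"
        using lt lex_append_iff[OF v12(2)] unfolding v12(1) by blast
      then show False
      proof
        assume a: "v1 = w' \<and> (v2, u) \<in> lex (measure r)"
        then have "h2 = h" using ev c vc unfolding g1_def g'_def by simp
        then have "eval_word G (w @ v2) = g \<otimes> h"
          using sets vsets unfolding g_def h2_def by (simp add: eval_word_append)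
        then show False using min[of "w @ v2"] l vl v12(3) a lex_append_iff[of w w v2 u] by simp
      next
        assume a: "(v1, w') \<in> lex (measure r)"
        \<comment> \<open>\<open>v\<close> is geodesic: it is as long as \<open>w' @ u\<close>,
          which is geodesic by \<open>cone_type_determined\<close>.\<close>
        have vgeo: "cayley_geodesic G A (\<lambda>i. \<one> \<otimes> eval_word G (take i v)) (length v) \<one> (g' \<otimes> h)"
          using cayley_geodesic_of_word[OF gen(1) one_closed v(1)] v e len len' c by simp
        have h_le: "word_length G A h \<le> length u" unfolding h_def using word_length_le[OF l(3)] .
        have "word_dist G A \<one> g' + word_dist G A g' (g' \<otimes> h) = word_dist G A \<one> (g' \<otimes> h)"
          using c len' h_le word_length_mult[OF gen(1) c(2,3)]
          by (simp add: word_dist_one word_dist_mult)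
        then obtain j where j: "j \<le> length v" "word_dist G A g' (\<one> \<otimes> eval_word G (take j v)) \<le> D"
          using D[OF c(2) vgeo] by blast
        define y where "y = eval_word G (take j v)"
        have yc: "y \<in> carrier G"
          unfolding y_def
          by (rule eval_word_closed[OF order_trans[OF set_take_subset lists_carrier[OF gen(1) v(1)]]])
        have gy: "word_dist G A g' y \<le> D" using j(2) yc unfolding y_def by simp
        have dist: "word_dist G A (\<one> \<otimes> eval_word G (take i v)) (\<one> \<otimes> eval_word G (take i' v)) = i' - i"
          if "i \<le> i'" "i' \<le> length v" for i i'
          using vgeo that unfolding cayley_geodesic_def by blast
        have y0: "word_length G A y = j"
          using dist[of 0 j] j(1) yc unfolding y_def by (simp add: word_dist_one)
        have wl: "length w' \<le> length v" using v(2) by simp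
        have "word_dist G A y g1 = (if j \<le> length w' then length w' - j else j - length w')"
          using dist[of j "length w'"] dist[of "length w'" j] j(1) wl yc vc word_dist_sym[OF A yc vc(1)]
          unfolding y_def g1_def v1_def by simp
        \<comment> \<open>\<open>y\<close> is within \<open>D\<close> of \<open>g'\<close>, so their
          lengths \<open>j\<close> and \<open>length w'\<close> differ by at most \<open>D\<close>.
          Moving along \<open>v\<close> from \<open>y\<close> to \<open>g1\<close> costs another
          \<open>D\<close>, which explains the radius \<open>2 * D\<close>.\<close>
        moreover have "length w' \<le> j + D" "j \<le> length w' + D"
          using word_dist_triangle[OF gen(1) one_closed yc c(2)]
            word_dist_triangle[OF gen(1) one_closed c(2) yc] gy word_dist_sym[OF A c(2) yc] len(2) y0 c yc
          by (simp_all add: word_dist_one)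
        ultimately have "word_dist G A y g1 \<le> D" by (simp split: if_splits)
        then have near: "word_dist G A g' g1 \<le> 2 * D"
          using word_dist_triangle[OF gen(1) c(2) yc vc(1)] gy by linarith
        define k where "k = inv g' \<otimes> g1"
        have k: "k \<in> carrier G" "g1 = g' \<otimes> k" "word_length G A k \<le> 2 * D"
          using near c vc unfolding k_def word_dist_def by auto
        have "k \<in> smaller_neighbours A r (2 * D) w'"
          using k vl(1) v12(2) a unfolding smaller_neighbours_def g'_def g1_def by auto
        then obtain v' where v': "v' \<in> lists A" "length v' = length w" "eval_word G v' = g \<otimes> k"
            "(v', w) \<in> lex (measure r)"
          using nb unfolding smaller_neighbours_def g_def by blast
        have "k \<otimes> h2 = h"
          using ev c k(1) vc unfolding k(2) by (simp add: m_assoc)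
        then have "eval_word G (v' @ v2) = g \<otimes> h"
          using v' vsets lists_carrier[OF gen(1) v'(1)] c k(1) vc
          unfolding h2_def by (simp add: eval_word_append m_assoc)
        then show False
          using min[of "v' @ v2"] v' vl v12(3) lex_append_iff[OF v'(2), of v2 u] by simp
      qed
    qed
    then show ?thesis
      using l e(2) len(2) len' unfolding shortlex_language_def geodesic_word_def by simp
  qed
  then show ?thesis by blast
qed

lemma ex_combing:
  assumes hyp: "word_hyperbolic G"
  shows "\<exists>A L. symmetric_generating_set G A \<and> combing G A L"
proof -
  obtain A \<delta> where A: "symmetric_generating_set G A" and sl: "slim_triangles G A \<delta>"
    using hyp unfolding word_hyperbolic_def by blast
  note gen = symmetric_generating_setD(2,1)[OF A]
  obtain r :: "'a \<Rightarrow> nat" where r: "inj_on r A"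
    using finite_imp_inj_to_nat_seg[OF gen(2)] by blast
  define L where "L = shortlex_language A r"
  obtain D where D: "\<And>w w' u. w \<in> L \<Longrightarrow> w' \<in> L \<Longrightarrow>
    length_profile A (\<delta> + 1) A (eval_word G w) = length_profile A (\<delta> + 1) A (eval_word G w') \<Longrightarrow>
    smaller_neighbours A r D w = smaller_neighbours A r D w' \<Longrightarrow> w @ u \<in> L \<Longrightarrow> w' @ u \<in> L"
    using shortlex_future[OF hyp A sl, of r] unfolding L_def by blast
  have sub: "L \<subseteq> lists A" and geo: "\<forall>w\<in>L. geodesic_word G A w"
    unfolding L_def shortlex_language_def geodesic_word_def by auto
  have pc: "prefix_closed L" and bij: "bij_betw (eval_word G) L (carrier G)"
    unfolding L_def using shortlex_prefix_closed[OF gen(1)] shortlex_bij[OF gen(1) r] by auto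
  have Nil: "[] \<in> L" unfolding L_def shortlex_language_def geodesic_word_def by simp
  let ?c = "\<lambda>w. (length_profile A (\<delta> + 1) A (eval_word G w), smaller_neighbours A r D w)"
  \<comment> \<open>With \<open>\<phi>\<close> zero the futures record only continuations, and the
    construction yields plain regularity.\<close>
  have "finite (futures L (\<lambda>_. 0) ` L)"
  proof (rule finite_futuresI[where c = ?c])
    have "eval_word G ` L = carrier G" using bij unfolding bij_betw_def by blast
    then have "?c ` L \<subseteq> length_profile A (\<delta> + 1) A ` carrier G \<times>
        Pow {k \<in> carrier G. word_length G A k \<le> D}"
      unfolding smaller_neighbours_def by blast
    then show "finite (?c ` L)"
      using finite_length_profiles[OF gen gen(1)] finite_Pow_iff[THEN iffD2, OF finite_word_ball[OF gen]]
      by (rule finite_subset[OF _ finite_cartesian_product])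
  next
    fix w w' u assume "w \<in> L" "w' \<in> L" "?c w = ?c w'" "w @ u \<in> L"
    then show "w' @ u \<in> L \<and> (0::int) - 0 = 0 - 0" using D[of w w' u] by simp
  qed
  from ex_parameterization[OF gen(2) sub pc Nil this] have "\<exists>V v E. parameterizes A V v E L"
    by blast
  then have "combing G A L" unfolding combing_def using sub pc bij geo by blast
  then show ?thesis using A by blast
qed

end

theorem theorem3p13:
  fixes G :: "('a, 'b) monoid_scheme" and S :: "'a set"
    and \<phi>\<^sub>S \<phi>\<^sub>S' \<psi>\<^sub>S :: "'a \<Rightarrow> int"
  assumes "word_hyperbolic G"
    and "finite S" and "semigroup_generating_set G S"
    and "\<phi>\<^sub>S = (\<lambda>g. int (word_length G S g))"
    and "\<phi>\<^sub>S' = (\<lambda>g. int (word_length G (set_inv\<^bsub>G\<^esub> S) g))"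
    and "\<psi>\<^sub>S = (\<lambda>g. \<phi>\<^sub>S g - \<phi>\<^sub>S' g)"
  shows "bicombable G \<phi>\<^sub>S \<and> bicombable G \<phi>\<^sub>S' \<and>
         bicombable G \<psi>\<^sub>S \<and> quasimorphism G (\<lambda>g. real_of_int (\<psi>\<^sub>S g))"
proof -
  interpret group G using assms(1) unfolding word_hyperbolic_def by blast
  have S: "word_generating_set S"
    using assms(3) unfolding semigroup_generating_set_def word_generating_set_def by blast
  have T: "word_generating_set (set_inv\<^bsub>G\<^esub> S)" using word_generating_set_set_inv[OF S] .
  have "finite (set_inv\<^bsub>G\<^esub> S)" using assms(2) unfolding SET_INV_def by simp
  \<comment> \<open>The coefficients \<open>(1, 0)\<close>, \<open>(0, 1)\<close> and
    \<open>(1, -1)\<close> will give the two lengths and their difference.\<close>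
  then have comb: "bicombable G
      (\<lambda>g. a * int (word_length G S g) + b * int (word_length G (set_inv\<^bsub>G\<^esub> S) g))" for a b
    unfolding bicombable_def
    using ex_combing[OF assms(1)] bicombable_wrt_word_lengths[OF assms(1) _ _ S assms(2) T] by blast
  obtain D where D: "\<And>a b. a \<in> carrier G \<Longrightarrow> b \<in> carrier G \<Longrightarrow>
    \<bar>(int (word_length G S a) - int (word_length G S (inv\<^bsub>G\<^esub> a))) +
     (int (word_length G S b) - int (word_length G S (inv\<^bsub>G\<^esub> b))) -
     (int (word_length G S (a \<otimes>\<^bsub>G\<^esub> b)) - int (word_length G S (inv\<^bsub>G\<^esub> (a \<otimes>\<^bsub>G\<^esub> b))))\<bar> \<le> D"
    using quasimorphism_word_length_diff[OF assms(1) S assms(2)] by blast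
  have "\<bar>\<psi>\<^sub>S a + \<psi>\<^sub>S b - \<psi>\<^sub>S (a \<otimes>\<^bsub>G\<^esub> b)\<bar> \<le> D" if "a \<in> carrier G" "b \<in> carrier G" for a b
    using D[OF that] that word_length_set_inv[OF S] unfolding assms(4-6) by simp
  then have "\<bar>real_of_int (\<psi>\<^sub>S a) + real_of_int (\<psi>\<^sub>S b) - real_of_int (\<psi>\<^sub>S (a \<otimes>\<^bsub>G\<^esub> b))\<bar> \<le> real_of_int D"
    if "a \<in> carrier G" "b \<in> carrier G" for a b
    using that by (metis of_int_abs of_int_add of_int_diff of_int_le_iff)
  then have "quasimorphism G (\<lambda>g. real_of_int (\<psi>\<^sub>S g))" unfolding quasimorphism_def by blast
  then show ?thesis
    using comb[of 1 0] comb[of 0 1] comb[of 1 "-1"] unfolding assms(4-6) by simp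
qed

end
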